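(* Let $\kappa>0$, $d\ge1$, $\Omega=\mathbb T^d$, $\tau>0$, and let $(u^n)_{n\ge0}$ be real-valued functions on $\Omega$, with starting values $u^0,u^1\in H^1(\Omega)$, satisfying the second-order BDF2 scheme $$\frac{3u^{n+1}-4u^n+u^{n-1}}{2\tau}=\kappa^2\Delta u^{n+1}+2\sin(u^n)-\sin(u^{n-1}),\qquad n\ge1.$$ If $0<\tau\le\frac12$, then $$\widetilde E(u^{n+1})\le\widetilde E(u^n),\qquad\forall\,n\ge1,$$ where $$\widetilde E(u^n)=\frac{\kappa^2}{2}\|\nabla u^n\|^2+\int_\Omega\cos(u^n)\,dx+\frac{1}{4\tau}\|u^n-u^{n-1}\|^2$$ is the modified energy.
   Context: $\mathbb T^d=[-\pi,\pi]^d$ is the torus (periodic boundary conditions), and $\|\cdot\|=\|\cdot\|_{2}$ is the $L^2(\Omega)$ norm. The scheme is discrete in time only (step size $\tau$) and continuous in space; given $u^n,u^{n-1}$, the function $u^{n+1}$ is the unique periodic solution of the linear elliptic equation above. The second starting value $u^1$ can be computed from $u^0$ by a first-order scheme, for example $\frac{u^{1}-u^0}{\tau}=\kappa^2\Delta u^{1}+\sin(u^0)$. Note that $\widetilde E(u^n)$ depends on both $u^n$ and $u^{n-1}$. *)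

theory Defs
  imports "HOL-Analysis.Analysis"
begin

section \<open>Function spaces on the torus\<close>

text \<open>
  A function on the \<open>d\<close>-dimensional torus, \<open>d = CARD('d)\<close>, is represented by a function on
  \<^typ>\<open>real ^ 'd\<close> of which only the values on the fundamental cell \<open>[-\<pi>, \<pi>]\<^sup>d\<close> matter, up to null
  sets. Periodicity is carried by the test functions below: they are periodic and need not vanish
  on the boundary of the cell, so a jump between opposite faces is seen by the weak derivatives.
\<close>

definition torus :: "(real ^ 'd) measure" where
  "torus = lebesgue_on (cbox (\<chi> i. - pi) (\<chi> i. pi))"

definition L2 :: "(real ^ 'd \<Rightarrow> real) set" where
  "L2 = {f. f \<in> borel_measurable torus \<and> integrable torus (\<lambda>x. (f x)\<^sup>2)}"

definition l2_norm :: "(real ^ 'd \<Rightarrow> 'b::real_normed_vector) \<Rightarrow> real" where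
  "l2_norm f = sqrt (LINT x|torus. (norm (f x))\<^sup>2)"

definition partial_deriv :: "'d::finite \<Rightarrow> (real ^ 'd \<Rightarrow> real) \<Rightarrow> real ^ 'd \<Rightarrow> real" where
  "partial_deriv i f x = frechet_derivative f (at x) (axis i 1)"

definition laplacian :: "(real ^ 'd::finite \<Rightarrow> real) \<Rightarrow> real ^ 'd \<Rightarrow> real" where
  "laplacian f x = (\<Sum>i\<in>UNIV. partial_deriv i (partial_deriv i f) x)"

fun Ck :: "nat \<Rightarrow> (real ^ 'd::finite \<Rightarrow> real) \<Rightarrow> bool" where
  "Ck 0 f \<longleftrightarrow> continuous_on UNIV f"
| "Ck (Suc k) f \<longleftrightarrow> (\<forall>x. f differentiable (at x)) \<and> (\<forall>i. Ck k (partial_deriv i f))"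

definition test_functions :: "(real ^ 'd::finite \<Rightarrow> real) set" where
  "test_functions = {\<phi>. (\<forall>k. Ck k \<phi>) \<and> (\<forall>x i. \<phi> (x + axis i (2 * pi)) = \<phi> x)}"

definition has_weak_grad :: "(real ^ 'd::finite \<Rightarrow> real) \<Rightarrow> (real ^ 'd \<Rightarrow> real ^ 'd) \<Rightarrow> bool" where
  "has_weak_grad u g \<longleftrightarrow> u \<in> L2 \<and> (\<forall>i. (\<lambda>x. g x $ i) \<in> L2) \<and>
     (\<forall>\<phi>\<in>test_functions. \<forall>i.
        (LINT x|torus. u x * partial_deriv i \<phi> x) = - (LINT x|torus. g x $ i * \<phi> x))"

definition H1 :: "(real ^ 'd::finite \<Rightarrow> real) set" where
  "H1 = {u. \<exists>g. has_weak_grad u g}"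

text \<open>Meaningful for \<open>u \<in> H1\<close> only, where it is determined up to a null set.\<close>

definition weak_grad :: "(real ^ 'd::finite \<Rightarrow> real) \<Rightarrow> real ^ 'd \<Rightarrow> real ^ 'd" where
  "weak_grad u = (SOME g. has_weak_grad u g)"

text \<open>
  \<open>has_weak_laplacian u w\<close>: the distributional Laplacian of \<open>u \<in> L2\<close> on the torus is the function
  \<open>w \<in> L2\<close>. By elliptic regularity, this is the case exactly if \<open>u \<in> H\<^sup>2\<close> and \<open>\<Delta>u = w\<close>.
\<close>

definition has_weak_laplacian :: "(real ^ 'd::finite \<Rightarrow> real) \<Rightarrow> (real ^ 'd \<Rightarrow> real) \<Rightarrow> bool" where
  "has_weak_laplacian u w \<longleftrightarrow> u \<in> L2 \<and> w \<in> L2 \<and>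
     (\<forall>\<phi>\<in>test_functions. (LINT x|torus. u x * laplacian \<phi> x) = (LINT x|torus. w x * \<phi> x))"


section \<open>The scheme and its modified energy\<close>

text \<open>
  One step of the scheme, with \<open>u\<close> the new iterate and \<open>v\<close>, \<open>v'\<close> the previous two: the equation
  holds almost everywhere on the torus, with the Laplacian understood in the distributional sense.
\<close>

definition bdf2_step ::
    "real \<Rightarrow> real \<Rightarrow> (real ^ 'd::finite \<Rightarrow> real) \<Rightarrow> (real ^ 'd \<Rightarrow> real) \<Rightarrow> (real ^ 'd \<Rightarrow> real) \<Rightarrow> bool" where
  "bdf2_step \<kappa> \<tau> u v v' \<longleftrightarrow> (\<exists>w. has_weak_laplacian u w \<and>
     (AE x in torus. (3 * u x - 4 * v x + v' x) / (2 * \<tau>)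
        = \<kappa>\<^sup>2 * w x + 2 * sin (v x) - sin (v' x)))"

text \<open>To be used for \<open>n \<ge> 1\<close> only, since \<open>n - 1\<close> is truncated.\<close>

definition modified_energy :: "real \<Rightarrow> real \<Rightarrow> (nat \<Rightarrow> real ^ 'd::finite \<Rightarrow> real) \<Rightarrow> nat \<Rightarrow> real" where
  "modified_energy \<kappa> \<tau> u n =
     \<kappa>\<^sup>2 / 2 * (l2_norm (weak_grad (u n)))\<^sup>2
     + (LINT x|torus. cos (u n x))
     + 1 / (4 * \<tau>) * (l2_norm (\<lambda>x. u n x - u (n - 1) x))\<^sup>2"

end

theory Submission
  imports Defs
begin

text \<open>
  Multiply the scheme by \<open>\<delta> = u\<^sup>n\<^sup>+\<^sup>1 - u\<^sup>n\<close> and integrate. With \<open>d = u\<^sup>n - u\<^sup>n\<^sup>-\<^sup>1\<close>, the difference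
  quotient becomes \<open>\<delta> (3 \<delta> - d) / (2 \<tau>)\<close>; the Laplacian term becomes the integral of
  \<open>- \<kappa>\<^sup>2 \<nabla>u\<^sup>n\<^sup>+\<^sup>1 \<cdot> \<nabla>\<delta>\<close>, which is at most that of \<open>\<kappa>\<^sup>2 (\<bar>\<nabla>u\<^sup>n\<bar>\<^sup>2 - \<bar>\<nabla>u\<^sup>n\<^sup>+\<^sup>1\<bar>\<^sup>2) / 2\<close>; and the
  sine terms are written as \<open>sin u\<^sup>n + (sin u\<^sup>n - sin u\<^sup>n\<^sup>-\<^sup>1)\<close> and compared with the decrease of
  the cosine, up to an error of \<open>\<delta>\<^sup>2 / 2 + \<bar>\<delta>\<bar> \<bar>d\<bar>\<close>. What remains is a quadratic form in
  \<open>(\<bar>\<delta>\<bar>, \<bar>d\<bar>)\<close>, and \<open>\<tau> \<le> 1 / 2\<close> is exactly the condition for it to be nonnegative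
  (\<open>energy_increment_le\<close>).

  The analytic content lies in the Laplacian term. The equation only provides \<open>u\<^sup>n\<^sup>+\<^sup>1\<close> and its
  distributional Laplacian in \<open>L\<^sup>2\<close>, so it has to be shown that \<open>u\<^sup>n\<^sup>+\<^sup>1\<close> has a gradient in
  \<open>L\<^sup>2\<close> (\<open>weak_laplacian_imp_H1\<close>) and that Green's identity holds against functions that are
  merely in \<open>H\<^sup>1\<close> (\<open>weak_green_identity\<close>). Both are read off from Fourier series. On the side of
  the coefficients, \<open>\<partial>\<^sub>i\<close> is multiplication by \<open>\<i> k\<^sub>i\<close> and \<open>\<Delta>\<close> is multiplication by \<open>- \<bar>k\<bar>\<^sup>2\<close>,
  because the trigonometric functions are admissible test functions; \<open>parseval\<close> and
  \<open>riesz_fischer\<close> translate between functions and coefficients. Parseval's identity rests on the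
  density of the trigonometric polynomials (\<open>square_integrable_trig_approximable\<close>), which comes
  from the Weierstrass theorem on the product of circles, and the Riesz-Fischer theorem on the
  completeness of \<open>L\<^sup>2\<close> (\<open>square_integrable_complete\<close>).
\<close>

section \<open>Square-integrable functions\<close>

definition square_integrable ::
    "'a measure \<Rightarrow> ('a \<Rightarrow> 'b::{banach, second_countable_topology}) \<Rightarrow> bool" where
  "square_integrable M f \<longleftrightarrow> f \<in> borel_measurable M \<and> integrable M (\<lambda>x. (norm (f x))\<^sup>2)"

lemma norm_diff_square_le:
  fixes a b c :: "'b::real_normed_vector"
  shows "(norm (a - c))\<^sup>2 \<le> 2 * (norm (a - b))\<^sup>2 + 2 * (norm (b - c))\<^sup>2"
proof -
  have "norm (a - c) \<le> norm (a - b) + norm (b - c)"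
    using norm_triangle_ineq[of "a - b" "b - c"] by simp
  then have "(norm (a - c))\<^sup>2 \<le> (norm (a - b) + norm (b - c))\<^sup>2"
    by (simp add: power_mono)
  also have "\<dots> \<le> 2 * (norm (a - b))\<^sup>2 + 2 * (norm (b - c))\<^sup>2"
    using zero_le_power2[of "norm (a - b) - norm (b - c)"]
    by (simp add: power2_eq_square algebra_simps)
  finally show ?thesis .
qed

lemma square_integrable_add:
  assumes "square_integrable M f" "square_integrable M g"
  shows "square_integrable M (\<lambda>x. f x + g x)"
proof -
  have [measurable]: "f \<in> borel_measurable M" "g \<in> borel_measurable M"
    using assms by (auto simp: square_integrable_def)
  have "integrable M (\<lambda>x. (norm (f x + g x))\<^sup>2)"
  proof (rule Bochner_Integration.integrable_bound)
    show "integrable M (\<lambda>x. 2 * (norm (f x))\<^sup>2 + 2 * (norm (g x))\<^sup>2)"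
      using assms by (auto simp: square_integrable_def)
    show "AE x in M. norm ((norm (f x + g x))\<^sup>2) \<le> norm (2 * (norm (f x))\<^sup>2 + 2 * (norm (g x))\<^sup>2)"
      using norm_diff_square_le[of "f _" "- g _" 0] by auto
  qed simp
  then show ?thesis by (simp add: square_integrable_def)
qed

lemma square_integrable_scaleR:
  "square_integrable M f \<Longrightarrow> square_integrable M (\<lambda>x. c *\<^sub>R f x)"
  by (auto simp: square_integrable_def power_mult_distrib intro!: borel_measurable_scaleR)

lemma square_integrable_mult_left:
  fixes c :: "'b::{banach, real_normed_field, second_countable_topology}"
  shows "square_integrable M f \<Longrightarrow> square_integrable M (\<lambda>x. c * f x)"
  by (auto simp: square_integrable_def power_mult_distrib norm_mult)

lemma square_integrable_diff:
  "square_integrable M f \<Longrightarrow> square_integrable M g \<Longrightarrow> square_integrable M (\<lambda>x. f x - g x)"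
  using square_integrable_add[of M f "\<lambda>x. (- 1) *\<^sub>R g x"] square_integrable_scaleR[of M g "- 1"]
  by simp

lemma square_integrable_mult:
  fixes f g :: "'a \<Rightarrow> 'b::{banach, real_normed_field, second_countable_topology}"
  assumes "square_integrable M f" "square_integrable M g"
  shows "integrable M (\<lambda>x. f x * g x)"
proof -
  have [measurable]: "f \<in> borel_measurable M" "g \<in> borel_measurable M"
    using assms by (auto simp: square_integrable_def)
  show ?thesis
  proof (rule Bochner_Integration.integrable_bound)
    show "integrable M (\<lambda>x. (norm (f x))\<^sup>2 + (norm (g x))\<^sup>2)"
      using assms by (auto simp: square_integrable_def)
    have "norm (f x) * norm (g x) \<le> (norm (f x))\<^sup>2 + (norm (g x))\<^sup>2" for x
      using zero_le_power2[of "norm (f x) - norm (g x)"]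
        mult_nonneg_nonneg[OF norm_ge_zero[of "f x"] norm_ge_zero[of "g x"]]
      unfolding power2_diff by linarith
    then show "AE x in M. norm (f x * g x) \<le> norm ((norm (f x))\<^sup>2 + (norm (g x))\<^sup>2)"
      by (simp add: norm_mult)
  qed simp
qed

lemma square_integrable_bounded:
  assumes "finite_measure M" "f \<in> borel_measurable M" "\<And>x. x \<in> space M \<Longrightarrow> norm (f x) \<le> B"
  shows "square_integrable M f"
proof -
  interpret finite_measure M by fact
  have "(norm (f x))\<^sup>2 \<le> B\<^sup>2" if "x \<in> space M" for x
    using assms(3)[OF that] by (simp add: power_mono)
  then have "integrable M (\<lambda>x. (norm (f x))\<^sup>2)"
    using assms(2) by (intro integrable_const_bound[where B = "B\<^sup>2"]) auto
  then show ?thesis using assms(2) by (simp add: square_integrable_def)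
qed

lemma square_integrable_of_real:
  fixes f :: "'a \<Rightarrow> real"
  shows "square_integrable M f \<Longrightarrow> square_integrable M (\<lambda>x. complex_of_real (f x))"
  by (auto simp: square_integrable_def intro!: borel_measurable_of_real)

lemma L2_iff: "f \<in> L2 \<longleftrightarrow> square_integrable torus f"
  by (simp add: L2_def square_integrable_def)

text \<open>
  On a finite measure space, a subsequence with \<open>\<parallel>f (r (k + 1)) - f (r k)\<parallel>\<^sup>2 < 4\<^sup>-\<^sup>k\<close> has
  absolutely summable increments in \<open>L\<^sup>1\<close>, hence almost everywhere, because
  \<open>2 t \<le> 2\<^sup>k t\<^sup>2 + 2\<^sup>-\<^sup>k\<close>. Fatou's lemma identifies its pointwise limit as the limit in the mean.
\<close>

proposition square_integrable_complete:
  fixes f :: "nat \<Rightarrow> 'a \<Rightarrow> 'b::{banach, second_countable_topology}"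
  assumes "finite_measure M" and f: "\<And>n. square_integrable M (f n)"
    and Cauchy: "\<And>e. e > 0 \<Longrightarrow> \<exists>N. \<forall>m\<ge>N. \<forall>n\<ge>N. (LINT x|M. (norm (f m x - f n x))\<^sup>2) < e"
  shows "\<exists>g. square_integrable M g \<and> (\<lambda>n. LINT x|M. (norm (f n x - g x))\<^sup>2) \<longlonglongrightarrow> 0"
proof -
  interpret finite_measure M by fact
  have [measurable]: "f n \<in> borel_measurable M" for n
    using f by (simp add: square_integrable_def)
  have int: "integrable M (\<lambda>x. (norm (f m x - f n x))\<^sup>2)" for m n
    using square_integrable_diff[OF f f] by (simp add: square_integrable_def)
  have "\<exists>N. \<forall>m\<ge>N. \<forall>n\<ge>N. (LINT x|M. (norm (f m x - f n x))\<^sup>2) < (1 / 4) ^ k" for k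
    by (rule Cauchy) simp
  then obtain N where N: "\<And>k m n. m \<ge> N k \<Longrightarrow> n \<ge> N k \<Longrightarrow>
      (LINT x|M. (norm (f m x - f n x))\<^sup>2) < (1 / 4) ^ k"
    by metis
  \<comment> \<open>Both \<open>r k\<close> and \<open>r (k + 1)\<close> are at least \<open>N k\<close>, and \<open>r\<close> tends to infinity.\<close>
  define r where "r k = (\<Sum>j\<le>k. N j) + k" for k :: nat
  have r_N: "r k \<ge> N k" "r (Suc k) \<ge> N k" for k
  proof -
    have "N k \<le> (\<Sum>j\<le>k. N j)" by (rule member_le_sum) auto
    then show "r k \<ge> N k" "r (Suc k) \<ge> N k" by (auto simp: r_def)
  qed
  have r_ge: "r k \<ge> k" for k by (simp add: r_def)
  define d where "d k x = f (r (Suc k)) x - f (r k) x" for k x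
  have [measurable]: "d k \<in> borel_measurable M" for k unfolding d_def by measurable
  define C where "C = 1 + measure M (space M)"
  have d1: "integrable M (\<lambda>x. norm (d k x))"
    and d2: "(LINT x|M. norm (d k x)) \<le> C * (1 / 2) ^ k" for k
  proof -
    have pt: "norm (d k x) \<le> 2 ^ k * (norm (d k x))\<^sup>2 + (1 / 2) ^ k" for x
    proof -
      have "0 \<le> (2 ^ k * norm (d k x) - 1)\<^sup>2 / 2 ^ k + norm (d k x)" by simp
      also have "\<dots> = 2 ^ k * (norm (d k x))\<^sup>2 + (1 / 2) ^ k - norm (d k x)"
        by (simp add: power2_eq_square field_simps)
      finally show ?thesis by simp
    qed
    have i2: "integrable M (\<lambda>x. 2 ^ k * (norm (d k x))\<^sup>2 + (1 / 2) ^ k)"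
      using int by (simp add: d_def)
    show i1: "integrable M (\<lambda>x. norm (d k x))"
      by (rule Bochner_Integration.integrable_bound[OF i2]) (use pt in auto)
    have "(LINT x|M. norm (d k x)) \<le> (LINT x|M. 2 ^ k * (norm (d k x))\<^sup>2 + (1 / 2) ^ k)"
      by (rule integral_mono[OF i1 i2 pt])
    also have "\<dots> = 2 ^ k * (LINT x|M. (norm (d k x))\<^sup>2) + (1 / 2) ^ k * measure M (space M)"
      using int by (simp add: d_def)
    also have "\<dots> \<le> 2 ^ k * (1 / 4) ^ k + (1 / 2) ^ k * measure M (space M)"
      using N[OF r_N(2) r_N(1), of k] by (simp add: d_def)
    also have "2 ^ k * (1 / 4) ^ k = (1 / 2 :: real) ^ k"
      by (simp flip: power_mult_distrib)
    finally show "(LINT x|M. norm (d k x)) \<le> C * (1 / 2) ^ k"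
      by (simp add: C_def algebra_simps)
  qed
  have summ: "AE x in M. summable (\<lambda>k. norm (d k x))"
  proof -
    have C: "C \<ge> 0" by (simp add: C_def)
    have "(\<integral>\<^sup>+x. (\<Sum>k. ennreal (norm (d k x))) \<partial>M) = (\<Sum>k. \<integral>\<^sup>+x. ennreal (norm (d k x)) \<partial>M)"
      by (rule nn_integral_suminf) simp
    also have "\<dots> = (\<Sum>k. ennreal (LINT x|M. norm (d k x)))"
      using d1 by (simp add: nn_integral_eq_integral)
    also have "\<dots> \<le> (\<Sum>k. ennreal (C * (1 / 2) ^ k))"
      using d2 by (intro suminf_le ennreal_leI) auto
    also have "\<dots> = ennreal (\<Sum>k. C * (1 / 2) ^ k)"
      using C by (intro suminf_ennreal2 summable_mult summable_geometric) auto
    also have "\<dots> < \<infinity>" by simp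
    finally have "AE x in M. (\<Sum>k. ennreal (norm (d k x))) \<noteq> \<infinity>"
      by (intro nn_integral_PInf_AE) auto
    then show ?thesis
      by eventually_elim (auto intro!: summable_suminf_not_top)
  qed
  define g where "g x = lim (\<lambda>k. f (r k) x)" for x
  have [measurable]: "g \<in> borel_measurable M" unfolding g_def by measurable
  have conv: "AE x in M. (\<lambda>k. f (r k) x) \<longlonglongrightarrow> g x"
    using summ
  proof eventually_elim
    case (elim x)
    have "(\<Sum>k<n. d k x) = f (r n) x - f (r 0) x" for n
      unfolding d_def by (rule sum_lessThan_telescope)
    then have "(\<lambda>n. f (r n) x - f (r 0) x) \<longlonglongrightarrow> (\<Sum>k. d k x)"
      using summable_LIMSEQ[OF summable_norm_cancel[OF elim]] by simp
    from tendsto_add[OF this tendsto_const[of "f (r 0) x"]] have "convergent (\<lambda>n. f (r n) x)"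
      by (auto simp: convergent_def)
    then show ?case by (simp add: g_def convergent_LIMSEQ_iff)
  qed
  have lim: "(\<integral>\<^sup>+x. ennreal ((norm (f n x - g x))\<^sup>2) \<partial>M) \<le> ennreal e"
    if "\<forall>m\<ge>N. \<forall>n\<ge>N. (LINT x|M. (norm (f m x - f n x))\<^sup>2) < e" "n \<ge> N" for n N e
  proof -
    have "(\<integral>\<^sup>+x. ennreal ((norm (f n x - g x))\<^sup>2) \<partial>M)
        = (\<integral>\<^sup>+x. liminf (\<lambda>k. ennreal ((norm (f n x - f (r k) x))\<^sup>2)) \<partial>M)"
    proof (rule nn_integral_cong_AE)
      show "AE x in M. ennreal ((norm (f n x - g x))\<^sup>2)
          = liminf (\<lambda>k. ennreal ((norm (f n x - f (r k) x))\<^sup>2))"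
        using conv
      proof eventually_elim
        case (elim x)
        have "(\<lambda>k. ennreal ((norm (f n x - f (r k) x))\<^sup>2)) \<longlonglongrightarrow> ennreal ((norm (f n x - g x))\<^sup>2)"
          by (intro tendsto_intros elim)
        then show ?case by (rule lim_imp_Liminf[OF trivial_limit_sequentially, symmetric])
      qed
    qed
    also have "\<dots> \<le> liminf (\<lambda>k. \<integral>\<^sup>+x. ennreal ((norm (f n x - f (r k) x))\<^sup>2) \<partial>M)"
      by (rule nn_integral_liminf) simp
    also have "\<dots> = liminf (\<lambda>k. ennreal (LINT x|M. (norm (f n x - f (r k) x))\<^sup>2))"
      using int by (simp add: nn_integral_eq_integral)
    also have "\<dots> \<le> ennreal e"
    proof (rule Liminf_le)
      show "\<forall>\<^sub>F k in sequentially. ennreal (LINT x|M. (norm (f n x - f (r k) x))\<^sup>2) \<le> ennreal e"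
        using eventually_ge_at_top[of N]
      proof eventually_elim
        case (elim k)
        with r_ge[of k] have "r k \<ge> N" by simp
        with that show ?case by (intro ennreal_leI less_imp_le) auto
      qed
    qed simp
    finally show ?thesis .
  qed
  have sqd: "square_integrable M (\<lambda>x. f n x - g x)"
    if "\<forall>m\<ge>N. \<forall>n\<ge>N. (LINT x|M. (norm (f m x - f n x))\<^sup>2) < e" "n \<ge> N" for n N e
  proof -
    have "(\<integral>\<^sup>+x. ennreal ((norm (f n x - g x))\<^sup>2) \<partial>M) < \<infinity>"
      using lim[OF that] by (rule le_less_trans) simp
    then have "integrable M (\<lambda>x. (norm (f n x - g x))\<^sup>2)"
      by (intro integrableI_bounded) simp_all
    then show ?thesis by (simp add: square_integrable_def)
  qed
  obtain N0 where N0: "\<forall>m\<ge>N0. \<forall>n\<ge>N0. (LINT x|M. (norm (f m x - f n x))\<^sup>2) < 1"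
    using Cauchy[of 1] by auto
  have "square_integrable M (\<lambda>x. f N0 x - (f N0 x - g x))"
    by (rule square_integrable_diff[OF f sqd[OF N0 order_refl]])
  then have g: "square_integrable M g" by simp
  have "(\<lambda>n. LINT x|M. (norm (f n x - g x))\<^sup>2) \<longlonglongrightarrow> 0"
  proof (rule LIMSEQ_I)
    fix e :: real assume e: "e > 0"
    obtain N where N: "\<forall>m\<ge>N. \<forall>n\<ge>N. (LINT x|M. (norm (f m x - f n x))\<^sup>2) < e / 2"
      using Cauchy[of "e / 2"] e by auto
    have "norm ((LINT x|M. (norm (f n x - g x))\<^sup>2) - 0) < e" if "n \<ge> N" for n
    proof -
      have "integrable M (\<lambda>x. (norm (f n x - g x))\<^sup>2)"
        using sqd[OF N that] by (simp add: square_integrable_def)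
      then have "ennreal (LINT x|M. (norm (f n x - g x))\<^sup>2) \<le> ennreal (e / 2)"
        using lim[OF N that] by (simp add: nn_integral_eq_integral)
      then have "(LINT x|M. (norm (f n x - g x))\<^sup>2) \<le> e / 2"
        using e by (simp add: ennreal_le_iff)
      then show ?thesis using e by simp
    qed
    then show "\<exists>N. \<forall>n\<ge>N. norm ((LINT x|M. (norm (f n x - g x))\<^sup>2) - 0) < e" by blast
  qed
  with g show ?thesis by blast
qed

section \<open>Integration of periodic functions over the cell\<close>

abbreviation cell :: "(real ^ 'd) set" where
  "cell \<equiv> cbox (\<chi> i. - pi) (\<chi> i. pi)"

lemma space_torus [simp]: "space torus = cell"
  by (simp add: torus_def)

lemma finite_measure_torus: "finite_measure torus"
  unfolding torus_def by (rule finite_measure_lebesgue_on) simp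

lemma continuous_measurable_torus:
  fixes f :: "real ^ 'd::finite \<Rightarrow> 'b::metric_space"
  assumes "continuous_on cell f"
  shows "f \<in> borel_measurable torus"
  unfolding torus_def using assms by (intro continuous_imp_measurable_on_sets_lebesgue) simp_all

lemma continuous_square_integrable:
  fixes f :: "real ^ 'd::finite \<Rightarrow> 'b::{banach, second_countable_topology}"
  assumes "continuous_on UNIV f"
  shows "square_integrable torus f"
proof -
  have c: "continuous_on cell f" using assms by (rule continuous_on_subset) simp
  then have "bounded (f ` cell)" by (intro compact_imp_bounded compact_continuous_image) auto
  then obtain B where "\<And>x. x \<in> cell \<Longrightarrow> norm (f x) \<le> B" by (auto simp: bounded_iff)
  then show ?thesis
    by (intro square_integrable_bounded[where B = B] finite_measure_torus continuous_measurable_torus c) auto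
qed

lemma square_integrable_const [simp]:
  "square_integrable (torus :: (real ^ 'd::finite) measure) (\<lambda>_. c)"
  by (rule continuous_square_integrable) simp

lemma square_integrable_imp_integrable:
  fixes f :: "real ^ 'd::finite \<Rightarrow> 'b::{banach, real_normed_field, second_countable_topology}"
  shows "square_integrable torus f \<Longrightarrow> integrable torus f"
  using square_integrable_mult[of torus f "\<lambda>_. 1"] by simp

lemma continuous_integrable_torus:
  fixes f :: "real ^ 'd::finite \<Rightarrow> real"
  assumes "continuous_on UNIV f"
  shows "integrable torus f"
  by (intro square_integrable_imp_integrable continuous_square_integrable assms)

lemma integral_torus_eq:
  fixes f :: "real ^ 'd::finite \<Rightarrow> real"
  assumes "continuous_on UNIV f"
  shows "(LINT x|torus. f x) = integral cell f"
  using continuous_integrable_torus[OF assms] unfolding torus_def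
  by (intro lebesgue_integral_eq_integral) simp_all

text \<open>
  The box \<open>[-\<pi>, \<pi>] \<times> \<dots> \<times> [-\<pi>, \<pi> + h] \<times> \<dots>\<close> is the union of the cell and a slab of
  thickness \<open>h\<close>, and also of the shifted cell and another such slab. The two slabs differ by a
  period.
\<close>

lemma integral_cell_shift_nonneg:
  fixes f :: "real ^ 'd::finite \<Rightarrow> real"
  assumes cont: "continuous_on UNIV f" and per: "\<And>x. f (x + axis i (2 * pi)) = f x"
    and h: "0 \<le> h" "h \<le> 2 * pi"
  shows "integral cell (\<lambda>x. f (x + axis i h)) = integral cell f"
proof -
  let ?a = "(\<chi> j. - pi) :: real ^ 'd" and ?b = "(\<chi> j. pi) :: real ^ 'd"
  let ?t = "axis i h :: real ^ 'd" and ?p = "axis i (2 * pi) :: real ^ 'd"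
  let ?e = "axis i 1 :: real ^ 'd"
  have e: "?e \<in> Basis" by (simp add: axis_in_Basis_iff)
  have int: "f integrable_on cbox u v" for u v
    by (intro integrable_continuous continuous_on_subset[OF cont]) simp
  have inner: "x \<bullet> ?e = x $ i" for x :: "real ^ 'd" by (simp add: inner_axis)
  \<comment> \<open>The cell with its side in direction \<open>i\<close> replaced by \<open>[-\<pi> + s, \<pi> + t]\<close>.\<close>
  define B where "B s t = cbox (?a + axis i s) (?b + axis i t)" for s t
  have B: "x \<in> B s t \<longleftrightarrow>
      (- pi + s \<le> x $ i \<and> x $ i \<le> pi + t) \<and> (\<forall>j. j \<noteq> i \<longrightarrow> - pi \<le> x $ j \<and> x $ j \<le> pi)" for x s t
    unfolding B_def mem_box_cart by (auto simp: axis_def)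
  have cell: "cell = B 0 0"
    by (simp add: B_def vec_eq_iff axis_def zero_vec_def[symmetric])
  have cut: "integral (B s t) f = integral (B s (c - pi)) f + integral (B (c + pi) t) f"
    if "- pi + s \<le> c" "c \<le> pi + t" for s t c
  proof -
    have "B s t \<inter> {x. x \<bullet> ?e \<le> c} = B s (c - pi)" "B s t \<inter> {x. x \<bullet> ?e \<ge> c} = B (c + pi) t"
      using that unfolding set_eq_iff Int_iff mem_Collect_eq B inner by force+
    then show ?thesis using integral_split[OF int e, of _ _ c] unfolding B_def by metis
  qed
  have "integral (B 0 h) f = integral (B 0 0) f + integral (B (2 * pi) h) f"
    using cut[of 0 pi h] h by simp
  moreover have "integral (B 0 h) f = integral (B 0 (h - 2 * pi)) f + integral (B h h) f"
    using cut[of 0 "h - pi" h] h by simp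
  moreover have "integral (B (2 * pi) h) f = integral (B 0 (h - 2 * pi)) f"
  proof -
    have eq: "B (2 * pi) h = cbox ((?a + axis i 0) + ?p) ((?b + axis i (h - 2 * pi)) + ?p)"
      unfolding B_def by (intro arg_cong2[of _ _ _ _ cbox]) (simp_all add: vec_eq_iff axis_def)
    have "integral (B (2 * pi) h) f = integral (B 0 (h - 2 * pi)) (f \<circ> ((+) ?p))"
      unfolding eq by (subst B_def) (rule integral_shift_cbox_plus[symmetric])
    also have "f \<circ> ((+) ?p) = f" using per by (auto simp: fun_eq_iff add.commute)
    finally show ?thesis .
  qed
  moreover have "integral (B h h) f = integral cell (\<lambda>x. f (x + ?t))"
    unfolding B_def integral_shift_cbox_plus[symmetric] by (simp add: o_def add.commute)
  ultimately have "integral cell (\<lambda>x. f (x + ?t)) = integral (B 0 0) f" by simp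
  then show ?thesis unfolding cell .
qed

lemma integral_cell_shift:
  fixes f :: "real ^ 'd::finite \<Rightarrow> real"
  assumes cont: "continuous_on UNIV f" and per: "\<And>x. f (x + axis i (2 * pi)) = f x"
    and h: "\<bar>h\<bar> \<le> 2 * pi"
  shows "integral cell (\<lambda>x. f (x + axis i h)) = integral cell f"
proof (cases "h \<ge> 0")
  case True
  then show ?thesis using integral_cell_shift_nonneg[OF cont per] h by simp
next
  case False
  have "f (x + axis i h) = f (x + axis i (h + 2 * pi))" for x
  proof -
    have "x + axis i (h + 2 * pi) = (x + axis i h) + axis i (2 * pi)"
      by (simp add: vec_eq_iff axis_def)
    then show ?thesis by (simp only: per)
  qed
  then show ?thesis
    using integral_cell_shift_nonneg[OF cont per, of "h + 2 * pi"] h False by simp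
qed

text \<open>
  The integral of a periodic function over shifted cells is constant in the shift; its derivative
  is the integral of the partial derivative.
\<close>

lemma integral_partial_deriv_eq_0:
  fixes f :: "real ^ 'd::finite \<Rightarrow> real"
  assumes diff: "\<And>x. f differentiable (at x)" and cont: "continuous_on UNIV (partial_deriv i f)"
    and per: "\<And>x. f (x + axis i (2 * pi)) = f x"
  shows "(LINT x|torus. partial_deriv i f x) = 0"
proof -
  have cf: "continuous_on UNIV f"
    using diff by (simp add: continuous_on_eq_continuous_at differentiable_imp_continuous_within)
  have ax: "axis i s = s *\<^sub>R axis i (1 :: real)" for s by (simp add: vec_eq_iff axis_def)
  have bl: "bounded_linear (\<lambda>s. axis i s :: real ^ 'd)"
    by (auto simp: linear_conv_bounded_linear[symmetric] linear_iff vec_eq_iff axis_def)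
  have deriv: "((\<lambda>s. f (t + axis i s)) has_field_derivative partial_deriv i f (t + axis i s)) (at s within U)"
    for s t U
  proof -
    have "((\<lambda>s. t + axis i s) has_derivative (\<lambda>s. axis i s)) (at s within U)"
      by (auto intro!: derivative_eq_intros bounded_linear_imp_has_derivative bl)
    moreover have "(f has_derivative frechet_derivative f (at (t + axis i s))) (at (t + axis i s))"
      using diff by (simp add: frechet_derivative_works)
    ultimately have "((\<lambda>s. f (t + axis i s)) has_derivative
        (\<lambda>s'. frechet_derivative f (at (t + axis i s)) (axis i s'))) (at s within U)"
      by (rule has_derivative_compose)
    moreover have "frechet_derivative f (at (t + axis i s)) (axis i s') = partial_deriv i f (t + axis i s) * s'" for s'
      using linear_frechet_derivative[OF diff] unfolding partial_deriv_def
      by (subst ax) (simp add: linear_cmul mult.commute)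
    ultimately show ?thesis by (simp add: has_field_derivative_def)
  qed
  \<comment> \<open>The shifts range over a neighbourhood of \<open>0\<close>, which makes the derivative two-sided.\<close>
  have "((\<lambda>s. integral cell (\<lambda>x. f (x + axis i s))) has_field_derivative
      integral cell (\<lambda>x. partial_deriv i f (x + axis i 0))) (at 0 within {-1..1})"
  proof (rule leibniz_rule_field_derivative)
    show "(\<lambda>x. f (x + axis i s)) integrable_on cell" for s
      by (intro integrable_continuous continuous_on_compose2[OF cf] continuous_intros) auto
    have "continuous_on UNIV (\<lambda>(s, x). x + axis i s :: real ^ 'd)"
      unfolding split_beta
      by (intro continuous_intros bounded_linear.continuous_on[OF bl])
    then show "continuous_on ({-1..1} \<times> cell) (\<lambda>(s, x). partial_deriv i f (x + axis i s))"
      unfolding split_beta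
      by (intro continuous_on_compose2[OF cont]) (auto intro: continuous_on_subset)
  qed (use deriv in auto)
  moreover have "integral cell (\<lambda>x. f (x + axis i s)) = integral cell f" if "s \<in> {-1..1}" for s
    using that pi_gt3 by (intro integral_cell_shift cf per) auto
  ultimately have "((\<lambda>s. integral cell f) has_field_derivative
      integral cell (partial_deriv i f)) (at 0 within {-1..1})"
    by (subst (asm) has_field_derivative_cong_eventually)
       (auto simp: eventually_at_filter axis_def zero_vec_def[symmetric])
  then have "((\<lambda>s. integral cell f) has_field_derivative integral cell (partial_deriv i f)) (at (0::real))"
    by (simp add: at_within_interior[of 0 "{-1..1::real}"])
  then have "integral cell (partial_deriv i f) = 0"
    using DERIV_const DERIV_unique by blast
  then show ?thesis using integral_torus_eq[OF cont] by simp
qed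

lemma partial_derivI:
  "(f has_derivative f') (at x) \<Longrightarrow> partial_deriv i f x = f' (axis i 1)"
  unfolding partial_deriv_def by (simp flip: frechet_derivative_at)

lemma integral_by_parts:
  fixes f g :: "real ^ 'd::finite \<Rightarrow> real"
  assumes f: "\<And>x. f differentiable (at x)" "continuous_on UNIV (partial_deriv i f)"
      "\<And>x. f (x + axis i (2 * pi)) = f x"
    and g: "\<And>x. g differentiable (at x)" "continuous_on UNIV (partial_deriv i g)"
      "\<And>x. g (x + axis i (2 * pi)) = g x"
  shows "(LINT x|torus. f x * partial_deriv i g x) = - (LINT x|torus. partial_deriv i f x * g x)"
proof -
  have cf: "continuous_on UNIV f" "continuous_on UNIV g"
    using f(1) g(1) by (simp_all add: continuous_on_eq_continuous_at differentiable_imp_continuous_within)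
  have pd: "partial_deriv i (\<lambda>x. f x * g x) x = f x * partial_deriv i g x + partial_deriv i f x * g x" for x
  proof -
    have "((\<lambda>x. f x * g x) has_derivative
      (\<lambda>h. f x * frechet_derivative g (at x) h + frechet_derivative f (at x) h * g x)) (at x)"
      using f(1) g(1) by (intro has_derivative_mult) (simp_all add: frechet_derivative_works)
    then show ?thesis by (simp add: partial_derivI) (simp add: partial_deriv_def)
  qed
  have "(LINT x|torus. partial_deriv i (\<lambda>x. f x * g x) x) = 0"
    using f g cf by (intro integral_partial_deriv_eq_0)
      (auto simp: pd[abs_def] intro!: continuous_intros differentiable_mult)
  moreover have "integrable torus (\<lambda>x. f x * partial_deriv i g x)"
      "integrable torus (\<lambda>x. partial_deriv i f x * g x)"
    using f(2) g(2) cf by (auto intro!: continuous_integrable_torus continuous_intros)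
  ultimately show ?thesis by (simp add: pd)
qed

section \<open>The characters of the torus\<close>

text \<open>
  Frequencies are integer vectors, so that \<open>exp (\<i> k \<cdot> x)\<close> has period \<open>2 \<pi>\<close> in each coordinate.
\<close>

definition phase :: "int ^ 'd::finite \<Rightarrow> real ^ 'd \<Rightarrow> real" where
  "phase k x = (\<Sum>i\<in>UNIV. of_int (k $ i) * x $ i)"

definition character :: "int ^ 'd::finite \<Rightarrow> real ^ 'd \<Rightarrow> complex" where
  "character k x = cis (phase k x)"

lemma phase_add: "phase (k + l) x = phase k x + phase l x"
  by (simp add: phase_def algebra_simps sum.distrib)

lemma phase_minus: "phase (- k) x = - phase k x"
  by (simp add: phase_def sum_negf)

lemma phase_zero [simp]: "phase 0 x = 0"
  by (simp add: phase_def)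

lemma phase_axis_int: "phase (axis j n) x = of_int n * x $ j"
proof -
  have "phase (axis j n) x = (\<Sum>i\<in>UNIV. if i = j then of_int n * x $ j else 0)"
    unfolding phase_def by (intro sum.cong) (auto simp: axis_def)
  then show ?thesis by simp
qed

lemma phase_axis: "phase k (axis i s) = of_int (k $ i) * s"
proof -
  have "phase k (axis i s) = (\<Sum>j\<in>UNIV. if j = i then of_int (k $ i) * s else 0)"
    unfolding phase_def by (intro sum.cong) (auto simp: axis_def)
  then show ?thesis by simp
qed

lemma phase_add_right: "phase k (x + y) = phase k x + phase k y"
  by (simp add: phase_def algebra_simps sum.distrib)

lemma bounded_linear_phase: "bounded_linear (phase k)"
  by (simp add: linear_conv_bounded_linear[symmetric] linear_iff phase_add_right)
    (simp add: phase_def sum_distrib_left algebra_simps)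

lemma character_mult: "character k x * character l x = character (k + l) x"
  by (simp add: character_def phase_add cis_mult)

lemma cnj_character: "cnj (character k x) = character (- k) x"
  by (simp add: character_def phase_minus cis_cnj)

lemma character_zero [simp]: "character 0 x = 1"
  by (simp add: character_def)

lemma continuous_character [continuous_intros]: "continuous_on S (character k)"
  unfolding character_def cis_conv_exp
  by (intro continuous_intros bounded_linear.continuous_on[OF bounded_linear_phase])

lemma square_integrable_character: "square_integrable torus (character k)"
  by (intro continuous_square_integrable continuous_intros)

text \<open>
  The real trigonometric functions of frequency \<open>k\<close> are closed under partial derivatives; this is
  what makes them smooth, and eigenfunctions of the Laplacian.
\<close>

definition trig :: "int ^ 'd::finite \<Rightarrow> real \<Rightarrow> real \<Rightarrow> real ^ 'd \<Rightarrow> real" where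
  "trig k a b x = a * cos (phase k x) + b * sin (phase k x)"

lemma trig_has_derivative:
  "(trig k a b has_derivative (\<lambda>h. trig k b (- a) x * phase k h)) (at x)"
  unfolding trig_def[abs_def]
  by (auto intro!: derivative_eq_intros bounded_linear_imp_has_derivative[OF bounded_linear_phase]
      simp: algebra_simps)

lemma partial_deriv_trig:
  "partial_deriv i (trig k a b) = trig k (of_int (k $ i) * b) (- of_int (k $ i) * a)"
  by (rule ext) (simp add: partial_derivI[OF trig_has_derivative] phase_axis trig_def algebra_simps)

lemma differentiable_trig: "trig k a b differentiable (at x)"
  using trig_has_derivative unfolding differentiable_def by blast

lemma Ck_trig: "Ck n (trig k a b)"
proof (induction n arbitrary: a b)
  case 0
  show ?case
    by (simp add: continuous_on_eq_continuous_at differentiable_trig differentiable_imp_continuous_within)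
next
  case (Suc n)
  then show ?case by (simp add: differentiable_trig partial_deriv_trig del: mult_minus_left)
qed

lemma trig_periodic: "trig k a b (x + axis i (2 * pi)) = trig k a b x"
proof -
  have "phase k (x + axis i (2 * pi)) = phase k x + 2 * pi * of_int (k $ i)"
    by (simp add: phase_add_right phase_axis)
  moreover have "cos (phase k x + 2 * pi * of_int (k $ i)) = cos (phase k x)"
      "sin (phase k x + 2 * pi * of_int (k $ i)) = sin (phase k x)"
    by (simp_all add: cos_add sin_add)
  ultimately show ?thesis by (simp add: trig_def)
qed

lemma trig_test_function: "trig k a b \<in> test_functions"
  by (simp add: test_functions_def Ck_trig trig_periodic)

lemma laplacian_trig:
  "laplacian (trig k a b) x = - (\<Sum>i\<in>UNIV. (of_int (k $ i))\<^sup>2) * trig k a b x"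
proof -
  have "laplacian (trig k a b) x = (\<Sum>i\<in>UNIV. (of_int (k $ i))\<^sup>2 * (- trig k a b x))"
    unfolding laplacian_def partial_deriv_trig
    by (intro sum.cong) (simp_all add: trig_def power2_eq_square algebra_simps)
  then show ?thesis by (simp add: sum_distrib_right sum_negf)
qed

lemma trig_zero: "trig 0 a b = (\<lambda>_. a)"
  by (simp add: trig_def fun_eq_iff)

lemma continuous_trig [continuous_intros]: "continuous_on S (trig k a b)"
  using Ck_trig[of 0] by (auto intro: continuous_on_subset)

lemma Re_character: "Re (character k x) = trig k 1 0 x"
  and Im_character: "Im (character k x) = trig k 0 1 x"
  by (simp_all add: character_def trig_def)

text \<open>
  If \<open>k\<^sub>i \<noteq> 0\<close>, a trigonometric function of frequency \<open>k\<close> is the \<open>i\<close>-th partial derivative of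
  another one. This gives the orthogonality of the characters.
\<close>

lemma integral_trig_eq_0:
  assumes "k \<noteq> (0 :: int ^ 'd::finite)"
  shows "(LINT x|torus. trig k a b x) = 0"
proof -
  obtain i where i: "k $ i \<noteq> 0" using assms by (auto simp: vec_eq_iff)
  define a' where "a' = - b / of_int (k $ i)"
  define b' where "b' = a / of_int (k $ i)"
  have "trig k a b = partial_deriv i (trig k a' b')"
    using i by (simp add: partial_deriv_trig a'_def b'_def)
  moreover have "(LINT x|torus. partial_deriv i (trig k a' b') x) = 0"
    by (intro integral_partial_deriv_eq_0 differentiable_trig trig_periodic)
      (simp add: partial_deriv_trig continuous_trig)
  ultimately show ?thesis by simp
qed

abbreviation (input) volume :: "'d::finite itself \<Rightarrow> real" where
  "volume _ \<equiv> measure (torus :: (real ^ 'd) measure) cell"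

lemma integral_complex_eq:
  assumes "integrable M (f :: 'a \<Rightarrow> complex)"
  shows "integral\<^sup>L M f = Complex (LINT x|M. Re (f x)) (LINT x|M. Im (f x))"
  using assms by (simp add: complex_eq_iff)

lemma integral_character:
  "(LINT x|torus. character k x)
    = (if k = (0 :: int ^ 'd::finite) then of_real (volume TYPE('d)) else 0)"
proof -
  have "integrable torus (character k)"
    by (intro square_integrable_imp_integrable square_integrable_character)
  from integral_complex_eq[OF this]
  have "(LINT x|torus. character k x) = Complex (LINT x|torus. trig k 1 0 x) (LINT x|torus. trig k 0 1 x)"
    by (simp only: Re_character Im_character)
  then show ?thesis
    by (simp add: integral_trig_eq_0 complex_eq_iff trig_zero)
qed

section \<open>Density of the trigonometric polynomials\<close>

inductive trig_poly :: "(real ^ 'd::finite \<Rightarrow> complex) \<Rightarrow> bool" where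
  monomial: "trig_poly (\<lambda>x. c * character k x)"
| add: "trig_poly p \<Longrightarrow> trig_poly q \<Longrightarrow> trig_poly (\<lambda>x. p x + q x)"

lemma trig_poly_const: "trig_poly (\<lambda>x. c)"
  using trig_poly.monomial[of c 0] by simp

lemma trig_poly_mult:
  assumes "trig_poly p" "trig_poly q"
  shows "trig_poly (\<lambda>x. p x * q x)"
  using assms(1)
proof induction
  case (monomial c k)
  show ?case
    using assms(2)
  proof induction
    case (monomial c' l)
    have "(\<lambda>x. c * character k x * (c' * character l x)) = (\<lambda>x. (c * c') * character (k + l) x)"
      by (auto simp: character_mult[symmetric])
    then show ?case by (simp add: trig_poly.monomial)
  qed (auto simp: distrib_left intro: trig_poly.add)
qed (auto simp: distrib_right intro: trig_poly.add)

lemma trig_poly_sum: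
  "finite I \<Longrightarrow> (\<And>i. i \<in> I \<Longrightarrow> trig_poly (p i)) \<Longrightarrow> trig_poly (\<lambda>x. \<Sum>i\<in>I. p i x)"
  by (induction I rule: finite_induct) (auto intro: trig_poly_const trig_poly.add)

lemma continuous_trig_poly: "trig_poly p \<Longrightarrow> continuous_on UNIV p"
  by (induction rule: trig_poly.induct) (auto intro!: continuous_intros)

lemma square_integrable_trig_poly: "trig_poly p \<Longrightarrow> square_integrable torus p"
  by (intro continuous_square_integrable continuous_trig_poly)

lemma trig_poly_expansion:
  assumes "trig_poly p"
  shows "\<exists>K a. finite K \<and> p = (\<lambda>x. \<Sum>k\<in>K. a k * character k x)"
  using assms
proof induction
  case (monomial c k)
  show ?case by (intro exI[of _ "{k}"] exI[of _ "\<lambda>_. c"]) simp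
next
  case (add p q)
  then obtain K a L b where *: "finite K" "p = (\<lambda>x. \<Sum>k\<in>K. a k * character k x)"
    "finite L" "q = (\<lambda>x. \<Sum>k\<in>L. b k * character k x)" by auto
  \<comment> \<open>Extend both coefficient families by \<open>0\<close> to the union of the frequency sets.\<close>
  define a' where "a' k = (if k \<in> K then a k else 0)" for k
  define b' where "b' k = (if k \<in> L then b k else 0)" for k
  have "(\<Sum>k\<in>K. a k * character k x) = (\<Sum>k\<in>K \<union> L. a' k * character k x)"
       "(\<Sum>k\<in>L. b k * character k x) = (\<Sum>k\<in>K \<union> L. b' k * character k x)" for x
    using * by (auto intro!: sum.mono_neutral_cong_left simp: a'_def b'_def)
  then show ?case using *
    by (intro exI[of _ "K \<union> L"] exI[of _ "\<lambda>k. a' k + b' k"])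
      (simp add: sum.distrib distrib_right)
qed

definition circle_map :: "real ^ 'd::finite \<Rightarrow> complex ^ 'd" where
  "circle_map x = (\<chi> j. cis (x $ j))"

lemma continuous_circle_map: "continuous_on S circle_map"
  unfolding circle_map_def cis_conv_exp by (intro continuous_intros)

text \<open>
  Coordinates with the same image differ by a multiple of \<open>2 \<pi>\<close>. Opposite faces of the cell are
  identified, so at least one of the two points has to be off the boundary.
\<close>

lemma circle_map_inj:
  assumes "x \<in> cell" "y \<in> box (\<chi> i. - pi) (\<chi> i. pi)" "circle_map x = circle_map y"
  shows "x = y"
proof -
  have "x $ j = y $ j" for j
  proof -
    have "cis (x $ j) = cis (y $ j)"
      using assms(3) by (simp add: circle_map_def vec_eq_iff)
    then have "cis (x $ j - y $ j) = 1" by (simp flip: cis_divide)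
    then have "cos (x $ j - y $ j) = 1" by (simp add: complex_eq_iff)
    then obtain n :: int where n: "x $ j - y $ j = of_int n * 2 * pi"
      by (auto simp: cos_one_2pi_int)
    moreover have "\<bar>x $ j - y $ j\<bar> < 2 * pi"
    proof -
      have "- pi \<le> x $ j" "x $ j \<le> pi" "- pi < y $ j" "y $ j < pi"
        using assms(1,2) by (auto simp: mem_box_cart)
      then show ?thesis by linarith
    qed
    ultimately have "\<bar>real_of_int n\<bar> * (2 * pi) < 1 * (2 * pi)" by (simp add: abs_mult)
    then have "\<bar>real_of_int n\<bar> < 1" by (subst (asm) mult_less_cancel_right) auto
    then have "n = 0" by linarith
    with n show ?thesis by simp
  qed
  then show ?thesis by (simp add: vec_eq_iff)
qed

lemma trig_poly_cos_sin:
  "trig_poly (\<lambda>x. of_real (cos (x $ j)))" "trig_poly (\<lambda>x. of_real (sin (x $ j)))"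
proof -
  have c: "(\<lambda>x. complex_of_real (cos (x $ j)))
      = (\<lambda>x. (1 / 2) * character (axis j 1) x + (1 / 2) * character (axis j (- 1)) x)"
    by (auto simp: character_def phase_axis_int complex_eq_iff)
  show "trig_poly (\<lambda>x. of_real (cos (x $ j)))"
    unfolding c by (intro trig_poly.intros)
  have s: "(\<lambda>x. complex_of_real (sin (x $ j)))
      = (\<lambda>x. (- \<i> / 2) * character (axis j 1) x + (\<i> / 2) * character (axis j (- 1)) x)"
    by (auto simp: character_def phase_axis_int complex_eq_iff)
  show "trig_poly (\<lambda>x. of_real (sin (x $ j)))"
    unfolding s by (intro trig_poly.intros)
qed

text \<open>
  The coordinates of \<open>circle_map x\<close> are \<open>cos x\<^sub>j\<close> and \<open>sin x\<^sub>j\<close>, so ordinary polynomials on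
  \<open>\<complex>\<^sup>d\<close> restrict to trigonometric polynomials. This carries the Weierstrass theorem for compact
  subsets of a Euclidean space over to the torus.
\<close>

lemma trig_poly_polynomial_circle_map:
  fixes q :: "complex ^ 'd::finite \<Rightarrow> real"
  assumes "real_polynomial_function q"
  shows "trig_poly (\<lambda>x. complex_of_real (q (circle_map x)))"
  using assms
proof induction
  case (linear f)
  interpret bounded_linear f by fact
  have "complex_of_real (f (circle_map x))
      = (\<Sum>j\<in>UNIV. of_real (cos (x $ j)) * of_real (f (axis j 1)) + of_real (sin (x $ j)) * of_real (f (axis j \<i>)))"
    for x :: "real ^ 'd"
  proof -
    have "circle_map x = (\<Sum>j\<in>UNIV. cos (x $ j) *\<^sub>R axis j 1 + sin (x $ j) *\<^sub>R axis j \<i>)"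
    proof (subst vec_eq_iff, rule allI)
      fix i
      have "(\<Sum>j\<in>UNIV. cos (x $ j) *\<^sub>R axis j 1 + sin (x $ j) *\<^sub>R axis j \<i>) $ i
          = (\<Sum>j\<in>UNIV. if j = i then cis (x $ i) else 0)"
        unfolding sum_component
        by (intro sum.cong) (auto simp: axis_def complex_eq_iff)
      then show "circle_map x $ i = (\<Sum>j\<in>UNIV. cos (x $ j) *\<^sub>R axis j 1 + sin (x $ j) *\<^sub>R axis j \<i>) $ i"
        by (simp add: circle_map_def)
    qed
    then show ?thesis by (simp add: sum add scaleR)
  qed
  then show ?case
    by (simp, intro trig_poly_sum trig_poly.add trig_poly_mult trig_poly_cos_sin trig_poly_const) auto
next
  case (const c)
  show ?case by (rule trig_poly_const)
next
  case (add f g)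
  then show ?case by (auto intro: trig_poly.add)
next
  case (mult f g)
  then show ?case by (auto intro: trig_poly_mult)
qed

definition trig_approximable :: "(real ^ 'd::finite \<Rightarrow> real) \<Rightarrow> bool" where
  "trig_approximable f \<longleftrightarrow> square_integrable torus f \<and>
     (\<forall>e>0. \<exists>p. trig_poly p \<and> (LINT x|torus. (norm (of_real (f x) - p x))\<^sup>2) < e)"

text \<open>
  A substitute for the triangle inequality that stays with squared distances.
\<close>

lemma integral_diff_square_le:
  fixes f g h :: "'a \<Rightarrow> 'b::{banach, second_countable_topology}"
  assumes "square_integrable M f" "square_integrable M g" "square_integrable M h"
  shows "(LINT x|M. (norm (f x - h x))\<^sup>2)
    \<le> 2 * (LINT x|M. (norm (f x - g x))\<^sup>2) + 2 * (LINT x|M. (norm (g x - h x))\<^sup>2)"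
proof -
  have i: "integrable M (\<lambda>x. (norm (f x - h x))\<^sup>2)" "integrable M (\<lambda>x. (norm (f x - g x))\<^sup>2)"
      "integrable M (\<lambda>x. (norm (g x - h x))\<^sup>2)"
    using assms square_integrable_diff unfolding square_integrable_def by blast+
  have "(LINT x|M. (norm (f x - h x))\<^sup>2)
      \<le> (LINT x|M. 2 * (norm (f x - g x))\<^sup>2 + 2 * (norm (g x - h x))\<^sup>2)"
    by (intro integral_mono norm_diff_square_le) (use i in auto)
  then show ?thesis using i by simp
qed

lemma trig_approximable_limit:
  assumes f: "square_integrable torus f"
    and g: "\<And>e. e > 0 \<Longrightarrow> \<exists>g. trig_approximable g \<and> (LINT x|torus. (f x - g x)\<^sup>2) < e"
  shows "trig_approximable f"
  unfolding trig_approximable_def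
proof (intro conjI allI impI f)
  fix e :: real assume e: "e > 0"
  obtain g where g1: "trig_approximable g" "(LINT x|torus. (f x - g x)\<^sup>2) < e / 4"
    using g[of "e / 4"] e by auto
  then obtain p where p: "trig_poly p" "(LINT x|torus. (norm (of_real (g x) - p x))\<^sup>2) < e / 4"
    unfolding trig_approximable_def using e by (meson divide_pos_pos zero_less_numeral)
  have "(LINT x|torus. (norm (of_real (f x) - p x))\<^sup>2)
      \<le> 2 * (LINT x|torus. (norm (complex_of_real (f x) - of_real (g x)))\<^sup>2)
        + 2 * (LINT x|torus. (norm (of_real (g x) - p x))\<^sup>2)"
    using f g1(1) p(1)
    by (intro integral_diff_square_le square_integrable_of_real square_integrable_trig_poly)
      (auto simp: trig_approximable_def)
  also have "\<dots> < e"
    using g1(2) p(2) by (simp flip: of_real_diff)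
  finally show "\<exists>p. trig_poly p \<and> (LINT x|torus. (norm (of_real (f x) - p x))\<^sup>2) < e"
    using p(1) by blast
qed

lemma trig_approximable_add:
  assumes "trig_approximable f" "trig_approximable g"
  shows "trig_approximable (\<lambda>x. f x + g x)"
  unfolding trig_approximable_def
proof (intro conjI allI impI)
  show "square_integrable torus (\<lambda>x. f x + g x)"
    using assms by (auto simp: trig_approximable_def intro: square_integrable_add)
  fix e :: real assume e: "e > 0"
  obtain p where p: "trig_poly p" "(LINT x|torus. (norm (of_real (f x) - p x))\<^sup>2) < e / 4"
    using assms(1) e unfolding trig_approximable_def by (meson divide_pos_pos zero_less_numeral)
  obtain q where q: "trig_poly q" "(LINT x|torus. (norm (of_real (g x) - q x))\<^sup>2) < e / 4"
    using assms(2) e unfolding trig_approximable_def by (meson divide_pos_pos zero_less_numeral)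
  have sq: "square_integrable torus (\<lambda>x. complex_of_real (f x))"
      "square_integrable torus (\<lambda>x. complex_of_real (g x))"
      "square_integrable torus p" "square_integrable torus q"
    using assms p q by (auto simp: trig_approximable_def square_integrable_of_real square_integrable_trig_poly)
  have "(LINT x|torus. (norm ((of_real (f x) + of_real (g x)) - (p x + q x)))\<^sup>2)
      \<le> 2 * (LINT x|torus. (norm ((of_real (f x) + of_real (g x)) - (p x + of_real (g x))))\<^sup>2)
        + 2 * (LINT x|torus. (norm ((p x + of_real (g x)) - (p x + q x)))\<^sup>2)"
    by (intro integral_diff_square_le square_integrable_add sq)
  also have "\<dots> < e" using p q by simp
  finally show "\<exists>p. trig_poly p \<and> (LINT x|torus. (norm (of_real (f x + g x) - p x))\<^sup>2) < e"
    using p(1) q(1) by (intro exI[of _ "\<lambda>x. p x + q x"]) (auto intro: trig_poly.add)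
qed

lemma trig_approximable_mult_left:
  assumes "trig_approximable f"
  shows "trig_approximable (\<lambda>x. c * f x)"
  unfolding trig_approximable_def
proof (intro conjI allI impI)
  show "square_integrable torus (\<lambda>x. c * f x)"
    using assms by (auto simp: trig_approximable_def intro: square_integrable_mult_left)
  fix e :: real assume e: "e > 0"
  have c: "c\<^sup>2 + 1 > 0" by (simp add: add_nonneg_pos)
  then obtain p where p: "trig_poly p" "(LINT x|torus. (norm (of_real (f x) - p x))\<^sup>2) < e / (c\<^sup>2 + 1)"
    using assms(1) e unfolding trig_approximable_def by (meson divide_pos_pos)
  let ?I = "LINT x|torus. (norm (of_real (f x) - p x))\<^sup>2"
  have "(LINT x|torus. (norm (of_real (c * f x) - of_real c * p x))\<^sup>2) = c\<^sup>2 * ?I"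
    by (subst integral_mult_right_zero[symmetric], intro Bochner_Integration.integral_cong)
      (simp_all add: norm_mult power_mult_distrib flip: right_diff_distrib)
  also have "\<dots> \<le> (c\<^sup>2 + 1) * ?I" by (simp add: distrib_right)
  also have "\<dots> < e" using p(2) c by (simp add: pos_less_divide_eq mult.commute)
  finally show "\<exists>p. trig_poly p \<and> (LINT x|torus. (norm (of_real (c * f x) - p x))\<^sup>2) < e"
    using trig_poly_mult[OF trig_poly_const p(1), of "of_real c"] by blast
qed

lemma trig_approximable_const_0: "trig_approximable (\<lambda>x. 0)"
  unfolding trig_approximable_def
  using trig_poly_const[of 0] by (auto intro!: exI[of _ "\<lambda>x. 0"])

lemma trig_approximable_sum:
  "finite I \<Longrightarrow> (\<And>i. i \<in> I \<Longrightarrow> trig_approximable (f i)) \<Longrightarrow> trig_approximable (\<lambda>x. \<Sum>i\<in>I. f i x)"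
  by (induction I rule: finite_induct) (auto intro: trig_approximable_const_0 trig_approximable_add)

text \<open>
  By the Weierstrass theorem on the compact image of the cell the approximation is even uniform,
  and the cell has finite measure.
\<close>

lemma trig_approximable_continuous_circle_map:
  fixes g :: "complex ^ 'd::finite \<Rightarrow> real"
  assumes g: "continuous_on UNIV g"
  shows "trig_approximable (\<lambda>x. g (circle_map x))"
  unfolding trig_approximable_def
proof (intro conjI allI impI)
  interpret finite_measure "torus :: (real ^ 'd) measure" by (rule finite_measure_torus)
  show sq: "square_integrable torus (\<lambda>x. g (circle_map x))"
    by (intro continuous_square_integrable continuous_on_compose2[OF g continuous_circle_map]) simp
  fix e :: real assume e: "e > 0"
  define V where "V = volume TYPE('d)"
  have V: "V \<ge> 0" by (simp add: V_def)
  define \<delta> where "\<delta> = sqrt (e / (V + 1))"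
  have \<delta>: "\<delta> > 0" "\<delta>\<^sup>2 = e / (V + 1)" using e V by (auto simp: \<delta>_def)
  have "compact (circle_map ` (cell :: (real ^ 'd) set))"
    by (intro compact_continuous_image continuous_circle_map) simp
  then obtain q where q: "real_polynomial_function q"
      "\<And>z. z \<in> circle_map ` (cell :: (real ^ 'd) set) \<Longrightarrow> \<bar>g z - q z\<bar> < \<delta>"
    using Stone_Weierstrass_real_polynomial_function[of _ g \<delta>] \<delta>(1) g
    by (metis continuous_on_subset subset_UNIV)
  define p where "p = (\<lambda>x. complex_of_real (q (circle_map x)))"
  have p: "trig_poly p" unfolding p_def by (rule trig_poly_polynomial_circle_map[OF q(1)])
  have "square_integrable torus (\<lambda>x. complex_of_real (g (circle_map x)) - p x)"
    by (intro square_integrable_diff square_integrable_of_real sq square_integrable_trig_poly p)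
  then have "(LINT x|torus. (norm (of_real (g (circle_map x)) - p x))\<^sup>2) \<le> (LINT x|(torus :: (real ^ 'd) measure). \<delta>\<^sup>2)"
  proof (intro integral_mono)
    fix x :: "real ^ 'd" assume "x \<in> space torus"
    then have "norm (of_real (g (circle_map x)) - p x) \<le> \<delta>"
      unfolding p_def of_real_diff[symmetric] norm_of_real using q(2)[of "circle_map x"] by simp
    then show "(norm (of_real (g (circle_map x)) - p x))\<^sup>2 \<le> \<delta>\<^sup>2" by (simp add: power_mono)
  qed (auto simp: square_integrable_def)
  also have "\<dots> = \<delta>\<^sup>2 * V" by (simp add: V_def)
  also have "\<dots> < e" using e V by (simp add: \<delta> field_simps)
  finally show "\<exists>p. trig_poly p \<and> (LINT x|torus. (norm (of_real (g (circle_map x)) - p x))\<^sup>2) < e"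
    using p by blast
qed

text \<open>
  A compact subset of the open cell is the preimage of its compact image under \<open>circle_map\<close>, which
  is injective there; and the indicator of a compact set is a bounded pointwise limit of continuous
  functions.
\<close>

lemma trig_approximable_compact:
  fixes T :: "(real ^ 'd::finite) set"
  assumes T: "compact T" "T \<subseteq> box (\<chi> i. - pi) (\<chi> i. pi)"
  shows "trig_approximable (indicator T)"
proof (cases "T = {}")
  case True
  then have "indicator T = (\<lambda>_. 0 :: real)" by (simp add: fun_eq_iff)
  then show ?thesis using trig_approximable_const_0 by simp
next
  case False
  interpret finite_measure "torus :: (real ^ 'd) measure" by (rule finite_measure_torus)
  define S where "S = circle_map ` T"
  have S: "compact S" "S \<noteq> {}" "closed S"
    unfolding S_def using T False
    by (auto intro!: compact_continuous_image continuous_circle_map compact_imp_closed)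
  have memS: "circle_map x \<in> S \<longleftrightarrow> x \<in> T" if "x \<in> cell" for x
    using circle_map_inj[OF that] T(2) by (auto simp: S_def)
  have Tm: "T \<in> sets torus"
  proof -
    have "T \<in> sets lebesgue" using T(1) by (intro fmeasurableD lmeasurable_compact)
    moreover have "T \<subseteq> cell" using T(2) box_subset_cbox by blast
    ultimately show ?thesis unfolding torus_def by (subst sets_restrict_space_iff) auto
  qed
  define g where "g n z = max 0 (1 - real n * infdist z S)" for n z
  have gc: "continuous_on UNIV (g n)" for n
    unfolding g_def
    by (intro continuous_on_max continuous_on_diff continuous_on_mult continuous_on_const
        continuous_on_infdist continuous_on_id)
  have bound: "0 \<le> g n z" "g n z \<le> 1" for n z
    by (auto simp: g_def infdist_nonneg)
  have lim: "(\<lambda>n. g n (circle_map x)) \<longlonglongrightarrow> indicator T x" if x: "x \<in> cell" for x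
  proof (cases "x \<in> T")
    case True
    then have "infdist (circle_map x) S = 0" using memS[OF x] by simp
    then show ?thesis using True by (simp add: g_def)
  next
    case False
    then have pos: "infdist (circle_map x) S > 0"
      using memS[OF x] S in_closed_iff_infdist_zero infdist_nonneg[of "circle_map x" S]
      by (metis less_eq_real_def)
    obtain N :: nat where N: "1 / infdist (circle_map x) S \<le> real N" using real_arch_simple by blast
    have "g n (circle_map x) = 0" if "n \<ge> N" for n
    proof -
      have "1 / infdist (circle_map x) S \<le> real n" using N that by linarith
      then show ?thesis using pos by (simp add: g_def field_simps)
    qed
    then have "\<forall>\<^sub>F n in sequentially. g n (circle_map x) = 0"
      by (auto simp: eventually_sequentially)
    then show ?thesis using False by (simp add: tendsto_eventually)
  qed
  have sq: "square_integrable torus (indicator T :: _ \<Rightarrow> real)"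
    using Tm by (intro square_integrable_bounded[where B = 1] finite_measure_torus) (auto simp: indicator_def)
  show ?thesis
  proof (rule trig_approximable_limit[OF sq])
    have [measurable]: "(\<lambda>x. g n (circle_map x)) \<in> borel_measurable torus" for n
      by (intro continuous_measurable_torus continuous_on_compose2[OF gc continuous_circle_map]) simp
    have "(\<lambda>n. LINT x|torus. (indicator T x - g n (circle_map x))\<^sup>2) \<longlonglongrightarrow> (LINT x|(torus :: (real ^ 'd) measure). 0)"
    proof (rule integral_dominated_convergence[where w = "\<lambda>_. 1"])
      show "AE x in torus. (\<lambda>n. (indicator T x - g n (circle_map x))\<^sup>2) \<longlonglongrightarrow> 0"
      proof (rule AE_I2)
        fix x :: "real ^ 'd" assume "x \<in> space torus"
        then have "(\<lambda>n. (indicator T x - g n (circle_map x))\<^sup>2) \<longlonglongrightarrow> (indicator T x - indicator T x)\<^sup>2"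
          by (intro tendsto_intros lim) simp
        then show "(\<lambda>n. (indicator T x - g n (circle_map x))\<^sup>2) \<longlonglongrightarrow> 0" by simp
      qed
      show "AE x in torus. norm ((indicator T x - g n (circle_map x))\<^sup>2) \<le> 1" for n
      proof (rule AE_I2)
        fix x :: "real ^ 'd"
        have "\<bar>indicator T x - g n (circle_map x)\<bar> \<le> 1"
          using bound[of n "circle_map x"] by (auto simp: indicator_def)
        then show "norm ((indicator T x - g n (circle_map x))\<^sup>2) \<le> 1"
          by (simp add: power_le_one_iff abs_square_le_1)
      qed
    qed (use Tm in auto)
    then show "\<exists>g. trig_approximable g \<and> (LINT x|torus. (indicator T x - g x)\<^sup>2) < e" if "e > 0" for e
      using order_tendstoD(2)[of _ 0 _ e] that trig_approximable_continuous_circle_map[OF gc]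
      by (fastforce simp: eventually_sequentially)
  qed
qed

text \<open>
  The boundary of the cell is a null set, and what is left of \<open>A\<close> can be exhausted in measure by
  compact subsets of the open cell.
\<close>

lemma trig_approximable_indicator:
  fixes A :: "(real ^ 'd::finite) set"
  assumes A: "A \<in> sets torus"
  shows "trig_approximable (indicator A)"
proof (rule trig_approximable_limit)
  interpret finite_measure "torus :: (real ^ 'd) measure" by (rule finite_measure_torus)
  show "square_integrable torus (indicator A :: _ \<Rightarrow> real)"
    using A by (intro square_integrable_bounded[where B = 1] finite_measure_torus) (auto simp: indicator_def)
  let ?box = "box (\<chi> i. - pi) (\<chi> i. pi) :: (real ^ 'd) set"
  fix e :: real assume e: "e > 0"
  have A': "A \<in> sets lebesgue" "A \<subseteq> cell"
    using A unfolding torus_def by (auto simp: sets_restrict_space_iff)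
  then have "A \<inter> ?box \<in> sets lebesgue" by (intro sets.Int) (simp_all add: borel_open)
  then obtain T where T: "closed T" "T \<subseteq> A \<inter> ?box" "A \<inter> ?box - T \<in> lmeasurable"
      "emeasure lebesgue (A \<inter> ?box - T) < ennreal e"
    using sets_lebesgue_inner_closed e by metis
  have "T \<subseteq> cell" using T(2) A'(2) by blast
  then have cT: "compact T"
    using T(1) bounded_subset[OF bounded_cbox] by (simp add: compact_eq_bounded_closed)
  have Tl: "T \<in> sets lebesgue" using T(1) by (simp add: borel_closed)
  have "emeasure torus (A - T) = emeasure lebesgue (A - T)"
    unfolding torus_def using A' by (intro emeasure_restrict_space) auto
  also have "\<dots> \<le> emeasure lebesgue ((A \<inter> ?box - T) \<union> (cell - ?box))"
    using A' T Tl by (intro emeasure_mono) auto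
  also have "\<dots> = emeasure lebesgue (A \<inter> ?box - T)"
    using T(3) negligible_frontier_interval
    by (intro emeasure_Un_null_set) (auto simp: negligible_iff_null_sets)
  also have "\<dots> < ennreal e" by fact
  finally have m: "measure torus (A - T) < e"
    using e by (simp add: emeasure_eq_measure ennreal_less_iff)
  have "(LINT x|torus. (indicator A x - indicator T x)\<^sup>2) = (LINT x|torus. indicator (A - T) x :: real)"
    using T(2) by (intro Bochner_Integration.integral_cong) (auto simp: indicator_def)
  also have "\<dots> = measure torus (A - T)"
    using A' by (simp add: Int_absorb2 subset_iff)
  finally have "(LINT x|torus. (indicator A x - indicator T x)\<^sup>2) < e" using m by simp
  then show "\<exists>g. trig_approximable g \<and> (LINT x|torus. (indicator A x - g x)\<^sup>2) < e"
    using trig_approximable_compact[OF cT] T(2) by blast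
qed

lemma trig_approximable_cong:
  assumes "\<And>x. x \<in> cell \<Longrightarrow> f x = g x"
  shows "trig_approximable f \<longleftrightarrow> trig_approximable g"
proof -
  have "square_integrable torus f \<longleftrightarrow> square_integrable torus g"
    unfolding square_integrable_def using assms
    by (intro conj_cong measurable_cong Bochner_Integration.integrable_cong) auto
  moreover have "(LINT x|torus. (norm (of_real (f x) - p x))\<^sup>2) = (LINT x|torus. (norm (of_real (g x) - p x))\<^sup>2)"
    for p :: "_ \<Rightarrow> complex"
    using assms by (intro Bochner_Integration.integral_cong) auto
  ultimately show ?thesis by (simp add: trig_approximable_def)
qed

text \<open>
  Simple functions are linear combinations of indicators, and they approximate \<open>f\<close> pointwise under
  the bound \<open>2 \<bar>f\<bar>\<close>, hence also in the mean.
\<close>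

proposition square_integrable_trig_approximable:
  fixes f :: "real ^ 'd::finite \<Rightarrow> real"
  assumes f: "square_integrable torus f"
  shows "trig_approximable f"
proof (rule trig_approximable_limit[OF f])
  have [measurable]: "f \<in> borel_measurable torus" and f2: "integrable torus (\<lambda>x. (f x)\<^sup>2)"
    using f by (auto simp: square_integrable_def)
  obtain F where F: "\<And>i. simple_function torus (F i)" "\<And>x. x \<in> cell \<Longrightarrow> (\<lambda>i. F i x) \<longlonglongrightarrow> f x"
      "\<And>i x. x \<in> cell \<Longrightarrow> \<bar>F i x\<bar> \<le> 2 * \<bar>f x\<bar>"
    using borel_measurable_implies_sequence_metric[of f torus 0] by (simp add: dist_norm) metis
  have [measurable]: "F i \<in> borel_measurable torus" for i
    by (rule borel_measurable_simple_function[OF F(1)])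
  have Fa: "trig_approximable (F i)" for i
  proof -
    have eq: "F i x = (\<Sum>y\<in>F i ` cell. y * indicator (F i -` {y} \<inter> cell) x)" if "x \<in> cell" for x
    proof -
      have "(\<Sum>y\<in>F i ` cell. y * indicator (F i -` {y} \<inter> cell) x) = (\<Sum>y\<in>F i ` cell. if y = F i x then F i x else 0)"
        using that by (intro sum.cong) (auto simp: indicator_def)
      also have "\<dots> = F i x"
        using that simple_functionD(1)[OF F(1)] by (subst sum.delta) auto
      finally show ?thesis by simp
    qed
    have "trig_approximable (\<lambda>x. \<Sum>y\<in>F i ` cell. y * indicator (F i -` {y} \<inter> cell) x)"
      using simple_functionD[OF F(1), of i]
      by (intro trig_approximable_sum trig_approximable_mult_left trig_approximable_indicator) auto
    moreover have "trig_approximable (F i) \<longleftrightarrow>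
        trig_approximable (\<lambda>x. \<Sum>y\<in>F i ` cell. y * indicator (F i -` {y} \<inter> cell) x)"
      by (rule trig_approximable_cong) (rule eq)
    ultimately show ?thesis by (simp only:)
  qed
  have "(\<lambda>i. LINT x|torus. (f x - F i x)\<^sup>2) \<longlonglongrightarrow> (LINT x|(torus :: (real ^ 'd) measure). 0)"
  proof (rule integral_dominated_convergence[where w = "\<lambda>x. 9 * (f x)\<^sup>2"])
    show "AE x in torus. (\<lambda>i. (f x - F i x)\<^sup>2) \<longlonglongrightarrow> 0"
    proof (rule AE_I2)
      fix x :: "real ^ 'd" assume "x \<in> space torus"
      then have "(\<lambda>i. (f x - F i x)\<^sup>2) \<longlonglongrightarrow> (f x - f x)\<^sup>2"
        by (intro tendsto_intros F(2)) simp
      then show "(\<lambda>i. (f x - F i x)\<^sup>2) \<longlonglongrightarrow> 0" by simp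
    qed
    show "AE x in torus. norm ((f x - F i x)\<^sup>2) \<le> 9 * (f x)\<^sup>2" for i
    proof (rule AE_I2)
      fix x :: "real ^ 'd" assume "x \<in> space torus"
      then have "\<bar>f x - F i x\<bar> \<le> \<bar>3 * f x\<bar>" using F(3)[of x i] by simp
      then have "(f x - F i x)\<^sup>2 \<le> (3 * f x)\<^sup>2" by (simp only: abs_le_square_iff)
      then show "norm ((f x - F i x)\<^sup>2) \<le> 9 * (f x)\<^sup>2" by (simp add: power_mult_distrib)
    qed
  qed (use f2 in auto)
  then show "\<exists>g. trig_approximable g \<and> (LINT x|torus. (f x - g x)\<^sup>2) < e" if "e > 0" for e
    using order_tendstoD(2)[of _ 0 _ e] that Fa by (fastforce simp: eventually_sequentially)
qed

section \<open>Fourier coefficients and Parseval's identity\<close>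

text \<open>
  The coefficients are not normalised. With this convention the volume of the cell appears in
  Parseval's identity, and in the coefficients of the trigonometric sums that approximate \<open>f\<close>.
\<close>

definition fourier :: "(real ^ 'd::finite \<Rightarrow> real) \<Rightarrow> int ^ 'd \<Rightarrow> complex" where
  "fourier f k = (LINT x|torus. of_real (f x) * cnj (character k x))"

lemma volume_pos: "volume TYPE('d::finite) > 0"
proof -
  have "volume TYPE('d) = measure lebesgue (cell :: (real ^ 'd) set)"
    unfolding torus_def by (subst measure_restrict_space) auto
  also have "\<dots> = (\<Prod>i\<in>(Basis :: (real ^ 'd) set). ((\<chi> i. pi) - (\<chi> i. - pi)) \<bullet> i)"
    by (subst measure_completion) (auto simp: measure_lborel_cbox_eq Basis_vec_def inner_axis)
  also have "\<dots> > 0" by (intro prod_pos) (auto simp: Basis_vec_def inner_axis)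
  finally show ?thesis .
qed

lemma integrable_mult_cnj_character:
  assumes "square_integrable torus f"
  shows "integrable torus (\<lambda>x. of_real (f x) * cnj (character k x))"
  unfolding cnj_character
  by (intro square_integrable_mult square_integrable_of_real square_integrable_character assms)

lemma fourier_add:
  "square_integrable torus f \<Longrightarrow> square_integrable torus g \<Longrightarrow>
    fourier (\<lambda>x. f x + g x) k = fourier f k + fourier g k"
  by (simp add: fourier_def distrib_right integrable_mult_cnj_character)

lemma fourier_diff:
  "square_integrable torus f \<Longrightarrow> square_integrable torus g \<Longrightarrow>
    fourier (\<lambda>x. f x - g x) k = fourier f k - fourier g k"
  by (simp add: fourier_def left_diff_distrib integrable_mult_cnj_character)

text \<open>
  The coefficients are thus determined by testing \<open>f\<close> against real trigonometric functions, which
  is what weak derivatives allow.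
\<close>

lemma fourier_eq:
  assumes "square_integrable torus f"
  shows "fourier f k = Complex (LINT x|torus. f x * trig k 1 0 x) (- (LINT x|torus. f x * trig k 0 1 x))"
  unfolding fourier_def integral_complex_eq[OF integrable_mult_cnj_character[OF assms]]
  by (simp add: Re_character Im_character)

lemma fourier_uminus_index: "fourier f (- k) = cnj (fourier f k)"
  unfolding fourier_def Bochner_Integration.integral_cnj[symmetric] by (simp add: cnj_character)

text \<open>
  The distance of \<open>f\<close> from an arbitrary trigonometric polynomial with frequencies in \<open>K\<close>, by
  completing the square. The polynomial with the coefficients of \<open>f\<close> itself minimises it.
\<close>

lemma integral_diff_trig_sum:
  fixes f :: "real ^ 'd::finite \<Rightarrow> real" and a :: "int ^ 'd \<Rightarrow> complex"
  assumes f: "square_integrable torus f" and K: "finite K"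
  defines "V \<equiv> volume TYPE('d)"
  shows "(LINT x|torus. (norm (of_real (f x) - (\<Sum>k\<in>K. a k * character k x)))\<^sup>2)
    = (LINT x|torus. (f x)\<^sup>2) - (\<Sum>k\<in>K. (norm (fourier f k))\<^sup>2) / V
      + V * (\<Sum>k\<in>K. (norm (a k - fourier f k / of_real V))\<^sup>2)"
proof -
  have V: "V > 0" unfolding V_def by (rule volume_pos)
  define p where "p x = (\<Sum>k\<in>K. a k * character k x)" for x
  have f2: "integrable torus (\<lambda>x. (f x)\<^sup>2)" using f by (simp add: square_integrable_def)
  have ic: "integrable torus (\<lambda>x. a k * (cnj (a l) * character (k - l) x))" for k l
    by (intro integrable_mult_right square_integrable_imp_integrable square_integrable_character)
  have ifc: "integrable torus (\<lambda>x. cnj (a k) * (of_real (f x) * cnj (character k x)))" for k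
    by (intro integrable_mult_right integrable_mult_cnj_character f)
  define S where "S x = (\<Sum>k\<in>K. cnj (a k) * (of_real (f x) * cnj (character k x)))" for x
  define T where "T x = (\<Sum>k\<in>K. \<Sum>l\<in>K. a k * (cnj (a l) * character (k - l) x))" for x
  have expand: "complex_of_real ((norm (of_real (f x) - p x))\<^sup>2)
      = of_real ((f x)\<^sup>2) - S x - cnj (S x) + T x" for x
  proof -
    have 1: "S x = of_real (f x) * cnj (p x)"
      by (simp add: S_def p_def sum_distrib_left mult_ac)
    have 2: "T x = p x * cnj (p x)"
    proof -
      have "character (k - l) x = character k x * cnj (character l x)" for k l
        by (simp add: cnj_character character_mult)
      then show ?thesis by (simp add: T_def p_def sum_product mult_ac)
    qed
    show ?thesis
      unfolding complex_norm_square 1 2 by (simp add: algebra_simps power2_eq_square)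
  qed
  have int: "integrable torus S" "integrable torus (\<lambda>x. cnj (S x))" "integrable torus T"
      "integrable torus (\<lambda>x. complex_of_real ((f x)\<^sup>2))"
    unfolding S_def T_def using ifc ic f2
    by (intro Bochner_Integration.integrable_sum integrable_cnj integrable_of_real; simp)+
  have S: "(LINT x|torus. S x) = (\<Sum>k\<in>K. cnj (a k) * fourier f k)"
    unfolding S_def using ifc by (subst Bochner_Integration.integral_sum) (auto simp: fourier_def)
  have T: "(LINT x|torus. T x)
      = (\<Sum>k\<in>K. \<Sum>l\<in>K. a k * (cnj (a l) * (if k = l then of_real V else 0)))"
    unfolding V_def T_def using ic
    by (simp add: Bochner_Integration.integral_sum Bochner_Integration.integrable_sum
        integral_character)
  have "complex_of_real (LINT x|torus. (norm (of_real (f x) - p x))\<^sup>2)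
      = (LINT x|torus. complex_of_real ((norm (of_real (f x) - p x))\<^sup>2))"
    by (rule integral_complex_of_real[symmetric])
  also have "\<dots> = (LINT x|torus. complex_of_real ((f x)\<^sup>2)) - (LINT x|torus. S x)
      - (LINT x|torus. cnj (S x)) + (LINT x|torus. T x)"
    unfolding expand using int
    by (simp only: Bochner_Integration.integral_add Bochner_Integration.integral_diff
        Bochner_Integration.integrable_add Bochner_Integration.integrable_diff)
  also have "\<dots> = of_real (LINT x|torus. (f x)\<^sup>2)
      - (\<Sum>k\<in>K. cnj (a k) * fourier f k) - cnj (\<Sum>k\<in>K. cnj (a k) * fourier f k)
      + (\<Sum>k\<in>K. \<Sum>l\<in>K. a k * (cnj (a l) * (if k = l then of_real V else 0)))"
    by (simp only: integral_complex_of_real Bochner_Integration.integral_cnj S T)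
  also have "(\<Sum>k\<in>K. \<Sum>l\<in>K. a k * (cnj (a l) * (if k = l then complex_of_real V else 0)))
      = (\<Sum>k\<in>K. of_real (V * (norm (a k))\<^sup>2))"
  proof (intro sum.cong refl)
    fix k assume "k \<in> K"
    have "(\<Sum>l\<in>K. a k * (cnj (a l) * (if k = l then complex_of_real V else 0)))
        = (\<Sum>l\<in>K. if k = l then a k * cnj (a k) * of_real V else 0)"
      by (intro sum.cong) auto
    also have "\<dots> = of_real (V * (norm (a k))\<^sup>2)"
      using K \<open>k \<in> K\<close> by (simp add: sum.delta' complex_norm_square del: of_real_power)
    finally show "(\<Sum>l\<in>K. a k * (cnj (a l) * (if k = l then complex_of_real V else 0)))
        = of_real (V * (norm (a k))\<^sup>2)" .
  qed
  finally have "(LINT x|torus. (norm (of_real (f x) - p x))\<^sup>2)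
      = (LINT x|torus. (f x)\<^sup>2) + (\<Sum>k\<in>K. V * (norm (a k))\<^sup>2 - 2 * Re (cnj (a k) * fourier f k))"
    by (simp add: complex_eq_iff sum_subtractf sum_distrib_left sum.distrib sum_negf)
  also have "(\<Sum>k\<in>K. V * (norm (a k))\<^sup>2 - 2 * Re (cnj (a k) * fourier f k))
      = (\<Sum>k\<in>K. V * (norm (a k - fourier f k / of_real V))\<^sup>2 - (norm (fourier f k))\<^sup>2 / V)"
  proof (intro sum.cong refl)
    fix k
    have "(norm (a k - fourier f k / of_real V))\<^sup>2
        = (norm (a k))\<^sup>2 - 2 * Re (cnj (a k) * fourier f k) / V + (norm (fourier f k))\<^sup>2 / V\<^sup>2"
      unfolding cmod_power2 using V by (simp add: power2_eq_square field_simps)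
    then show "V * (norm (a k))\<^sup>2 - 2 * Re (cnj (a k) * fourier f k)
        = V * (norm (a k - fourier f k / of_real V))\<^sup>2 - (norm (fourier f k))\<^sup>2 / V"
      using V by (simp add: power2_eq_square field_simps)
  qed
  finally show ?thesis
    unfolding p_def by (simp add: sum_subtractf sum_distrib_left sum_divide_distrib)
qed

lemma bessel_inequality:
  fixes f :: "real ^ 'd::finite \<Rightarrow> real"
  assumes "square_integrable torus f" "finite K"
  shows "(\<Sum>k\<in>K. (norm (fourier f k))\<^sup>2) \<le> volume TYPE('d) * (LINT x|torus. (f x)\<^sup>2)"
proof -
  have "0 \<le> (LINT x|torus. (norm (of_real (f x)
      - (\<Sum>k\<in>K. fourier f k / of_real (volume TYPE('d)) * character k x)))\<^sup>2)"
    by (intro integral_nonneg_AE) auto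
  also have "\<dots> = (LINT x|torus. (f x)\<^sup>2) - (\<Sum>k\<in>K. (norm (fourier f k))\<^sup>2) / volume TYPE('d)"
    by (subst integral_diff_trig_sum[OF assms]) simp
  finally show ?thesis
    using volume_pos[where 'd = 'd] by (simp add: pos_divide_le_eq mult.commute)
qed

text \<open>
  Bessel's inequality bounds the sum from above. For the converse, a trigonometric polynomial close
  to \<open>f\<close> shows that the coefficients at its finitely many frequencies already account for almost all
  of the norm.
\<close>

lemma parseval_norm:
  fixes f :: "real ^ 'd::finite \<Rightarrow> real"
  assumes f: "square_integrable torus f"
  shows "((\<lambda>k. (norm (fourier f k))\<^sup>2) has_sum (volume TYPE('d) * (LINT x|torus. (f x)\<^sup>2))) UNIV"
proof -
  define V where "V = volume TYPE('d)"
  have V: "V > 0" unfolding V_def by (rule volume_pos)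
  have "((\<lambda>k. (norm (fourier f k))\<^sup>2) has_sum (SUP K\<in>{K. finite K \<and> K \<subseteq> UNIV}. \<Sum>k\<in>K. (norm (fourier f k))\<^sup>2)) UNIV"
    using bessel_inequality[OF f]
    by (intro nonneg_bdd_above_has_sum) (auto simp: bdd_above_def)
  moreover have "(SUP K\<in>{K. finite K \<and> K \<subseteq> UNIV}. \<Sum>k\<in>K. (norm (fourier f k))\<^sup>2)
      = V * (LINT x|torus. (f x)\<^sup>2)" (is "?S = _")
  proof (rule antisym)
    show "?S \<le> V * (LINT x|torus. (f x)\<^sup>2)"
      unfolding V_def using bessel_inequality[OF f] by (intro cSUP_least) auto
    show "V * (LINT x|torus. (f x)\<^sup>2) \<le> ?S"
    proof (rule field_le_epsilon)
      fix e :: real assume "e > 0"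
      then obtain p where p: "trig_poly p" "(LINT x|torus. (norm (of_real (f x) - p x))\<^sup>2) < e / V"
        using square_integrable_trig_approximable[OF f] V
        unfolding trig_approximable_def by (meson divide_pos_pos)
      then obtain K a where K: "finite K" "p = (\<lambda>x. \<Sum>k\<in>K. a k * character k x)"
        using trig_poly_expansion by blast
      have "0 \<le> V * (\<Sum>k\<in>K. (norm (a k - fourier f k / of_real V))\<^sup>2)"
        using V by (intro mult_nonneg_nonneg sum_nonneg) auto
      then have "(LINT x|torus. (f x)\<^sup>2) - (\<Sum>k\<in>K. (norm (fourier f k))\<^sup>2) / V < e / V"
        using p(2) unfolding K(2) integral_diff_trig_sum[OF f K(1)] V_def by linarith
      from mult_strict_left_mono[OF this V]
      have "V * (LINT x|torus. (f x)\<^sup>2) < (\<Sum>k\<in>K. (norm (fourier f k))\<^sup>2) + e"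
        using V by (simp add: right_diff_distrib)
      also have "(\<Sum>k\<in>K. (norm (fourier f k))\<^sup>2) \<le> ?S"
        using bessel_inequality[OF f] K(1) by (intro cSUP_upper) (auto simp: bdd_above_def)
      finally show "V * (LINT x|torus. (f x)\<^sup>2) \<le> ?S + e" by simp
    qed
  qed
  ultimately show ?thesis by (simp add: V_def)
qed

text \<open>
  By polarisation; the inner product is that of \<open>\<complex>\<close> as a real vector space, \<open>z \<bullet> w = Re (z * cnj w)\<close>.
\<close>

theorem parseval:
  fixes f g :: "real ^ 'd::finite \<Rightarrow> real"
  assumes f: "square_integrable torus f" and g: "square_integrable torus g"
  shows "((\<lambda>k. fourier f k \<bullet> fourier g k) has_sum (volume TYPE('d) * (LINT x|torus. f x * g x))) UNIV"
proof -
  define V where "V = volume TYPE('d)"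
  have polar: "((norm (z + w))\<^sup>2 - (norm (z - w))\<^sup>2) / 4 = z \<bullet> w" for z w :: complex
    by (simp add: power2_norm_eq_inner algebra_simps inner_commute)
  have i: "integrable torus (\<lambda>x. (f x + g x)\<^sup>2)" "integrable torus (\<lambda>x. (f x - g x)\<^sup>2)"
    using square_integrable_add[OF f g] square_integrable_diff[OF f g]
    by (simp_all add: square_integrable_def)
  have "((\<lambda>k. (norm (fourier (\<lambda>x. f x + g x) k))\<^sup>2 + - (norm (fourier (\<lambda>x. f x - g x) k))\<^sup>2)
      has_sum (V * (LINT x|torus. (f x + g x)\<^sup>2) + - (V * (LINT x|torus. (f x - g x)\<^sup>2)))) UNIV"
    unfolding V_def
    by (intro has_sum_add) (simp_all add: has_sum_uminus parseval_norm square_integrable_add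
        square_integrable_diff f g)
  from has_sum_cmult_right[OF this, of "1 / 4"]
  have "((\<lambda>k. fourier f k \<bullet> fourier g k) has_sum
      ((V * (LINT x|torus. (f x + g x)\<^sup>2) - V * (LINT x|torus. (f x - g x)\<^sup>2)) / 4)) UNIV"
    by (simp add: fourier_add[OF f g] fourier_diff[OF f g] polar)
  moreover have "(LINT x|torus. f x * g x)
      = ((LINT x|torus. (f x + g x)\<^sup>2) - (LINT x|torus. (f x - g x)\<^sup>2)) / 4"
  proof -
    have "f x * g x = ((f x + g x)\<^sup>2 - (f x - g x)\<^sup>2) / 4" for x
      by (simp add: power2_eq_square algebra_simps)
    then have "(LINT x|torus. f x * g x) = (LINT x|torus. ((f x + g x)\<^sup>2 - (f x - g x)\<^sup>2) / 4)"
      by (simp only:)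
    also have "\<dots> = ((LINT x|torus. (f x + g x)\<^sup>2) - (LINT x|torus. (f x - g x)\<^sup>2)) / 4"
      using i by simp
    finally show ?thesis .
  qed
  ultimately show ?thesis
    unfolding V_def by (simp only: times_divide_eq_right right_diff_distrib)
qed

section \<open>The Riesz-Fischer theorem\<close>

lemma finite_index_box: "finite {k :: int ^ 'd::finite. \<forall>i. \<bar>k $ i\<bar> \<le> N}"
proof (rule finite_subset)
  show "{k :: int ^ 'd. \<forall>i. \<bar>k $ i\<bar> \<le> N} \<subseteq> (\<lambda>f. \<chi> i. f i) ` (PiE UNIV (\<lambda>_. {- N..N}))"
  proof
    fix k :: "int ^ 'd" assume "k \<in> {k. \<forall>i. \<bar>k $ i\<bar> \<le> N}"
    then have "(\<lambda>i. k $ i) \<in> PiE UNIV (\<lambda>_. {- N..N})" by (force simp: abs_le_iff)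
    then show "k \<in> (\<lambda>f. \<chi> i. f i) ` (PiE UNIV (\<lambda>_. {- N..N}))"
      by (intro image_eqI[of _ _ "\<lambda>i. k $ i"]) (simp_all add: vec_eq_iff)
  qed
  show "finite ((\<lambda>f. \<chi> i. f i) ` (PiE UNIV (\<lambda>_. {- N..N})) :: (int ^ 'd) set)"
    by (intro finite_imageI finite_PiE) auto
qed

text \<open>
  The symmetry of \<open>a\<close> makes the partial sums over symmetric boxes of frequencies real-valued.
  They form a Cauchy sequence in the mean by orthogonality, and Bessel's inequality applied to a
  single frequency shows that taking a coefficient is continuous.
\<close>

theorem riesz_fischer:
  fixes a :: "int ^ 'd::finite \<Rightarrow> complex"
  assumes herm: "\<And>k. a (- k) = cnj (a k)" and summ: "(\<lambda>k. (norm (a k))\<^sup>2) summable_on UNIV"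
  shows "\<exists>g. square_integrable torus g \<and> (\<forall>k. fourier g k = a k)"
proof -
  define V where "V = volume TYPE('d)"
  have V: "V > 0" unfolding V_def by (rule volume_pos)
  define K where "K N = {k :: int ^ 'd. \<forall>i. \<bar>k $ i\<bar> \<le> int N}" for N :: nat
  have fK: "finite (K N)" for N unfolding K_def by (rule finite_index_box)
  have mono: "K M \<subseteq> K N" if "M \<le> N" for M N
    using that unfolding K_def by (auto intro: order_trans)
  have ex: "\<exists>N. k \<in> K N" for k
  proof -
    have "\<bar>k $ i\<bar> \<le> (\<Sum>j\<in>UNIV. \<bar>k $ j\<bar>)" for i by (rule member_le_sum) auto
    then have "k \<in> K (nat (\<Sum>j\<in>UNIV. \<bar>k $ j\<bar>))" by (simp add: K_def)
    then show ?thesis ..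
  qed
  have ex_finite: "\<exists>N. X \<subseteq> K N" if "finite X" for X
    using that
  proof induction
    case (insert k X)
    then obtain M N where "X \<subseteq> K M" "k \<in> K N" using ex by blast
    then have "insert k X \<subseteq> K (max M N)" using mono[of M "max M N"] mono[of N "max M N"] by auto
    then show ?case ..
  qed simp
  define s where "s N x = (\<Sum>k\<in>K N. a k / of_real V * character k x)" for N x
  define r where "r N x = Re (s N x)" for N x
  have s_real: "of_real (r N x) = s N x" for N x
  proof -
    have "cnj (s N x) = (\<Sum>k\<in>K N. a (- k) / of_real V * character (- k) x)"
      by (simp add: s_def cnj_character herm)
    also have "\<dots> = s N x"
      unfolding s_def by (rule sum.reindex_bij_witness[of _ uminus uminus]) (auto simp: K_def)
    finally show ?thesis unfolding r_def by (simp add: complex_eq_iff)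
  qed
  have sq: "square_integrable torus (r N)" for N
  proof -
    have "continuous_on UNIV (r N)"
      unfolding r_def s_def by (intro continuous_intros)
    then show ?thesis by (rule continuous_square_integrable)
  qed
  have norm_sum: "(LINT x|torus. (norm (\<Sum>k\<in>L. c k * character k x))\<^sup>2) = V * (\<Sum>k\<in>L. (norm (c k))\<^sup>2)"
    if "finite L" for L :: "(int ^ 'd) set" and c
    using integral_diff_trig_sum[OF square_integrable_const[of 0] that, of c]
    by (simp add: V_def fourier_def)
  have dist: "(LINT x|torus. (norm (r M x - r N x))\<^sup>2) \<le> (\<Sum>k\<in>(K M \<union> K N) - K n. (norm (a k))\<^sup>2) / V"
    if n: "n \<le> M" "n \<le> N" for M N n
  proof -
    \<comment> \<open>The coefficients of the difference of the two partial sums; they vanish on \<open>K n\<close>.\<close>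
    define c where "c k = (if k \<in> K M then a k / V else 0) - (if k \<in> K N then a k / V else 0)" for k
    have "(norm (r M x - r N x))\<^sup>2 = (norm (\<Sum>k\<in>K M \<union> K N. c k * character k x))\<^sup>2" for x
    proof -
      have "s M x = (\<Sum>k\<in>K M \<union> K N. (if k \<in> K M then a k / V else 0) * character k x)"
           "s N x = (\<Sum>k\<in>K M \<union> K N. (if k \<in> K N then a k / V else 0) * character k x)"
        unfolding s_def using fK by (auto intro!: sum.mono_neutral_cong_left)
      then have "complex_of_real (r M x - r N x) = (\<Sum>k\<in>K M \<union> K N. c k * character k x)"
        by (simp add: s_real c_def left_diff_distrib sum_subtractf)
      then show ?thesis by (metis norm_of_real real_norm_def)
    qed
    then have "(LINT x|torus. (norm (r M x - r N x))\<^sup>2) = V * (\<Sum>k\<in>K M \<union> K N. (norm (c k))\<^sup>2)"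
      using norm_sum[of "K M \<union> K N" c] fK by simp
    also have "(\<Sum>k\<in>K M \<union> K N. (norm (c k))\<^sup>2) = (\<Sum>k\<in>(K M \<union> K N) - K n. (norm (c k))\<^sup>2)"
      using fK mono[OF n(1)] mono[OF n(2)] by (intro sum.mono_neutral_right) (auto simp: c_def)
    also have "\<dots> \<le> (\<Sum>k\<in>(K M \<union> K N) - K n. (norm (a k))\<^sup>2 / V\<^sup>2)"
      using V by (intro sum_mono) (auto simp: c_def norm_divide power_divide)
    also have "V * \<dots> = (\<Sum>k\<in>(K M \<union> K N) - K n. (norm (a k))\<^sup>2) / V"
      using V by (simp add: sum_divide_distrib[symmetric] power2_eq_square)
    finally show ?thesis using V by simp
  qed
  have Cauchy: "\<exists>n. \<forall>M\<ge>n. \<forall>N\<ge>n. (LINT x|torus. (norm (r M x - r N x))\<^sup>2) < e" if e: "e > 0" for e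
  proof -
    obtain S where S: "((\<lambda>k. (norm (a k))\<^sup>2) has_sum S) UNIV" using summ by (auto simp: summable_on_def)
    obtain X where X: "finite X" "dist (\<Sum>k\<in>X. (norm (a k))\<^sup>2) S \<le> e * V / 2"
      using has_sum_finite_approximation[OF S, of "e * V / 2"] e V by auto
    obtain n where n: "X \<subseteq> K n" using ex_finite[OF X(1)] by blast
    have "(LINT x|torus. (norm (r M x - r N x))\<^sup>2) < e" if M: "M \<ge> n" and N: "N \<ge> n" for M N
    proof -
      have "(\<Sum>k\<in>X. (norm (a k))\<^sup>2) \<le> (\<Sum>k\<in>K n. (norm (a k))\<^sup>2)"
        using n fK by (intro sum_mono2) auto
      moreover have "(\<Sum>k\<in>(K M \<union> K N) - K n. (norm (a k))\<^sup>2) + (\<Sum>k\<in>K n. (norm (a k))\<^sup>2)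
          = (\<Sum>k\<in>K M \<union> K N. (norm (a k))\<^sup>2)"
        using fK mono[OF M] by (intro sum.subset_diff[symmetric]) auto
      moreover have "(\<Sum>k\<in>K M \<union> K N. (norm (a k))\<^sup>2) \<le> S"
        using fK by (intro has_sum_mono2[OF has_sum_finite S]) auto
      ultimately have "(\<Sum>k\<in>(K M \<union> K N) - K n. (norm (a k))\<^sup>2) \<le> e * V / 2"
        using X(2) unfolding dist_real_def by linarith
      also have "\<dots> < e * V" using e V by simp
      finally have "(\<Sum>k\<in>(K M \<union> K N) - K n. (norm (a k))\<^sup>2) / V < e"
        using V by (simp add: pos_divide_less_eq)
      with dist[OF M N] show ?thesis by linarith
    qed
    then show ?thesis by blast
  qed
  obtain g where g: "square_integrable torus g" "(\<lambda>n. LINT x|torus. (norm (r n x - g x))\<^sup>2) \<longlonglongrightarrow> 0"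
    using square_integrable_complete[OF finite_measure_torus sq Cauchy] by blast
  have coeff: "fourier (r N) k = a k" if "k \<in> K N" for k N
  proof -
    have "fourier (r N) k = (LINT x|torus. (\<Sum>l\<in>K N. a l / of_real V * character (l - k) x))"
      unfolding fourier_def s_real s_def sum_distrib_right cnj_character mult.assoc character_mult
      by simp
    also have "\<dots> = (\<Sum>l\<in>K N. a l / of_real V * (if l = k then of_real V else 0))"
      unfolding V_def
      by (simp add: Bochner_Integration.integral_sum square_integrable_imp_integrable
          square_integrable_character integral_character)
    also have "\<dots> = (\<Sum>l\<in>K N. if l = k then a k else 0)"
      using V by (intro sum.cong) auto
    also have "\<dots> = a k" using that fK by simp
    finally show ?thesis .
  qed
  have "fourier g k = a k" for k
  proof -
    obtain N where N: "k \<in> K N" using ex by blast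
    have "(norm (a k - fourier g k))\<^sup>2 \<le> V * (LINT x|torus. (norm (r n x - g x))\<^sup>2)" if "n \<ge> N" for n
    proof -
      have "fourier (\<lambda>x. r n x - g x) k = a k - fourier g k"
        using coeff[of k n] N mono[OF that] by (subst fourier_diff[OF sq g(1)]) auto
      then show ?thesis
        using bessel_inequality[of "\<lambda>x. r n x - g x" "{k}"] square_integrable_diff[OF sq g(1)]
        by (simp add: V_def)
    qed
    then have "(norm (a k - fourier g k))\<^sup>2 \<le> V * 0"
      by (intro LIMSEQ_le_const[OF tendsto_mult[OF tendsto_const g(2)]]) blast
    then show ?thesis by simp
  qed
  with g(1) show ?thesis by blast
qed


section \<open>Weak derivatives on the Fourier side\<close>

lemma integral_trig_scale:
  "(LINT x|torus. f x * trig k c 0 x) = c * (LINT x|torus. f x * trig k 1 0 x)"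
  "(LINT x|torus. f x * trig k 0 c x) = c * (LINT x|torus. f x * trig k 0 1 x)"
  by (simp_all add: trig_def mult.left_commute flip: integral_mult_right_zero)

text \<open>
  Obtained by testing with the cosine and the sine of frequency \<open>k\<close>, whose partial derivatives are
  multiples of each other.
\<close>

lemma fourier_weak_grad:
  assumes "has_weak_grad u g"
  shows "fourier (\<lambda>x. g x $ i) k = \<i> * of_int (k $ i) * fourier u k"
proof -
  have sq: "square_integrable torus u" "square_integrable torus (\<lambda>x. g x $ i)"
    using assms by (auto simp: has_weak_grad_def L2_iff)
  have test: "(LINT x|torus. u x * partial_deriv i (trig k a b) x)
      = - (LINT x|torus. g x $ i * trig k a b x)" for a b
    using assms trig_test_function unfolding has_weak_grad_def by blast
  have "(LINT x|torus. g x $ i * trig k 1 0 x) = of_int (k $ i) * (LINT x|torus. u x * trig k 0 1 x)"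
    using test[of 1 0] integral_trig_scale(2)[of u k "- of_int (k $ i)"]
    by (simp add: partial_deriv_trig)
  moreover have "(LINT x|torus. g x $ i * trig k 0 1 x) = - of_int (k $ i) * (LINT x|torus. u x * trig k 1 0 x)"
    using test[of 0 1] integral_trig_scale(1)[of u k "of_int (k $ i)"]
    by (simp add: partial_deriv_trig)
  ultimately show ?thesis
    unfolding fourier_eq[OF sq(1)] fourier_eq[OF sq(2)] by (simp add: complex_eq_iff)
qed

text \<open>
  The test functions of frequency \<open>k\<close> are eigenfunctions of the Laplacian with eigenvalue
  \<open>- \<bar>k\<bar>\<^sup>2\<close>.
\<close>

lemma fourier_weak_laplacian:
  assumes "has_weak_laplacian u w"
  shows "fourier w k = - of_real (\<Sum>i\<in>UNIV. (of_int (k $ i))\<^sup>2) * fourier u k"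
proof -
  have sq: "square_integrable torus u" "square_integrable torus w"
    using assms by (auto simp: has_weak_laplacian_def L2_iff)
  define q where "q = (\<Sum>i\<in>UNIV. (real_of_int (k $ i))\<^sup>2)"
  have "(LINT x|torus. w x * trig k a b x) = (LINT x|torus. u x * laplacian (trig k a b) x)" for a b
    using assms trig_test_function unfolding has_weak_laplacian_def by metis
  then have test: "(LINT x|torus. w x * trig k a b x) = - q * (LINT x|torus. u x * trig k a b x)" for a b
    unfolding laplacian_trig q_def[symmetric]
    by (simp add: mult.left_commute)
  show ?thesis
    unfolding fourier_eq[OF sq(1)] fourier_eq[OF sq(2)] test q_def[symmetric]
    by (simp add: complex_eq_iff)
qed

lemma test_functionD:
  assumes "\<phi> \<in> test_functions"
  shows "\<phi> differentiable (at x)" "continuous_on UNIV \<phi>" "continuous_on UNIV (partial_deriv i \<phi>)"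
    "\<phi> (x + axis i (2 * pi)) = \<phi> x"
proof -
  have "Ck (Suc 0) \<phi>" "Ck 0 \<phi>" using assms by (auto simp: test_functions_def simp del: Ck.simps)
  then show "\<phi> differentiable (at x)" "continuous_on UNIV \<phi>" "continuous_on UNIV (partial_deriv i \<phi>)"
    by auto
  show "\<phi> (x + axis i (2 * pi)) = \<phi> x" using assms by (simp add: test_functions_def)
qed

lemma test_function_has_weak_grad:
  assumes \<phi>: "\<phi> \<in> test_functions"
  shows "has_weak_grad \<phi> (\<lambda>x. \<chi> i. partial_deriv i \<phi> x)"
  unfolding has_weak_grad_def L2_iff
proof (intro conjI allI ballI)
  show "square_integrable torus \<phi>"
    by (intro continuous_square_integrable test_functionD[OF \<phi>])
  show "square_integrable torus (\<lambda>x. (\<chi> i. partial_deriv i \<phi> x) $ i)" for i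
    using test_functionD(3)[OF \<phi>] by (simp add: continuous_square_integrable)
  show "(LINT x|torus. \<phi> x * partial_deriv i \<psi> x) = - (LINT x|torus. (\<chi> i. partial_deriv i \<phi> x) $ i * \<psi> x)"
    if "\<psi> \<in> test_functions" for \<psi> i
    using test_functionD[OF \<phi>] test_functionD[OF that] by (simp add: integral_by_parts)
qed

text \<open>
  Let \<open>a\<close> and \<open>b\<close> be the coefficients of \<open>u\<close> and of its Laplacian \<open>w\<close>. The candidate coefficients
  \<open>\<i> k\<^sub>i a\<close> for the \<open>i\<close>-th partial derivative of \<open>u\<close> are square-summable, since
  \<open>k\<^sub>i\<^sup>2 \<bar>a\<bar>\<^sup>2 \<le> \<bar>k\<bar>\<^sup>2 \<bar>a\<bar>\<^sup>2 = \<bar>b\<bar> \<bar>a\<bar>\<close>, and so belong to a function by the Riesz-Fischer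
  theorem. Parseval's identity reduces the defining property of a weak derivative to the
  skew-symmetry of multiplication by \<open>\<i> k\<^sub>i\<close>.
\<close>

proposition weak_laplacian_imp_H1:
  fixes u :: "real ^ 'd::finite \<Rightarrow> real"
  assumes uw: "has_weak_laplacian u w"
  shows "u \<in> H1"
proof -
  have sq: "square_integrable torus u" "square_integrable torus w"
    using assms by (auto simp: has_weak_laplacian_def L2_iff)
  have "\<exists>g. square_integrable torus g \<and> (\<forall>k :: int ^ 'd. fourier g k = \<i> * of_int (k $ i) * fourier u k)" for i :: 'd
  proof (rule riesz_fischer)
    show "\<i> * of_int ((- k) $ i) * fourier u (- k) = cnj (\<i> * of_int (k $ i) * fourier u k)" for k
      by (simp add: fourier_uminus_index)
    have "(\<lambda>k. (norm (fourier w k))\<^sup>2 + (norm (fourier u k))\<^sup>2) summable_on UNIV"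
      using parseval_norm[OF sq(1)] parseval_norm[OF sq(2)]
      by (intro summable_on_add) (auto simp: summable_on_def)
    then show "(\<lambda>k. (norm (\<i> * of_int (k $ i) * fourier u k))\<^sup>2) summable_on UNIV"
    proof (rule summable_on_comparison_test)
      fix k :: "int ^ 'd"
      define q where "q = (\<Sum>i\<in>UNIV. (real_of_int (k $ i))\<^sup>2)"
      have ki: "(real_of_int (k $ i))\<^sup>2 \<le> q" unfolding q_def by (rule member_le_sum) auto
      have q: "q \<ge> 0" unfolding q_def by (intro sum_nonneg) auto
      have w: "norm (fourier w k) = q * norm (fourier u k)"
        unfolding fourier_weak_laplacian[OF uw] q_def[symmetric] using q by (simp add: norm_mult)
      have "(norm (\<i> * of_int (k $ i) * fourier u k))\<^sup>2 = (real_of_int (k $ i))\<^sup>2 * (norm (fourier u k))\<^sup>2"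
        by (simp add: norm_mult power_mult_distrib)
      also have "\<dots> \<le> q * (norm (fourier u k))\<^sup>2" using ki by (intro mult_right_mono) auto
      also have "\<dots> = norm (fourier w k) * norm (fourier u k)" by (simp add: w power2_eq_square)
      also have "\<dots> \<le> (norm (fourier w k))\<^sup>2 + (norm (fourier u k))\<^sup>2"
        using zero_le_power2[of "norm (fourier w k) - norm (fourier u k)"]
          mult_nonneg_nonneg[OF norm_ge_zero[of "fourier w k"] norm_ge_zero[of "fourier u k"]]
        unfolding power2_diff by linarith
      finally show "(norm (\<i> * of_int (k $ i) * fourier u k))\<^sup>2
          \<le> (norm (fourier w k))\<^sup>2 + (norm (fourier u k))\<^sup>2" .
    qed auto
  qed
  then obtain G where G: "\<And>i. square_integrable torus (G i)"
      "\<And>i k. fourier (G i) k = \<i> * of_int (k $ i) * fourier u k"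
    by metis
  have "has_weak_grad u (\<lambda>x. \<chi> i. G i x)"
    unfolding has_weak_grad_def L2_iff
  proof (intro conjI allI ballI)
    show "square_integrable torus u" by fact
    show "square_integrable torus (\<lambda>x. (\<chi> i. G i x) $ i)" for i using G(1) by simp
    fix \<phi> :: "real ^ 'd \<Rightarrow> real" and i assume \<phi>: "\<phi> \<in> test_functions"
    define D where "D = partial_deriv i \<phi>"
    have D: "square_integrable torus D" and sq\<phi>: "square_integrable torus \<phi>"
      unfolding D_def by (intro continuous_square_integrable test_functionD[OF \<phi>])+
    have "fourier D k = \<i> * of_int (k $ i) * fourier \<phi> k" for k
      using fourier_weak_grad[OF test_function_has_weak_grad[OF \<phi>], of i k] by (simp add: D_def)
    then have "fourier u k \<bullet> fourier D k = - (fourier (G i) k \<bullet> fourier \<phi> k)" for k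
      by (simp add: G(2) inner_complex_def algebra_simps)
    then have "((\<lambda>k. fourier u k \<bullet> fourier D k) has_sum
        - (volume TYPE('d) * (LINT x|torus. G i x * \<phi> x))) UNIV"
      using parseval[OF G(1) sq\<phi>, of i] by (simp add: has_sum_uminus)
    from has_sum_unique[OF this parseval[OF sq(1) D]]
    have "volume TYPE('d) * (LINT x|torus. u x * D x)
        = volume TYPE('d) * (- (LINT x|torus. G i x * \<phi> x))"
      by (simp only: mult_minus_right)
    then show "(LINT x|torus. u x * partial_deriv i \<phi> x) = - (LINT x|torus. (\<chi> i. G i x) $ i * \<phi> x)"
      using volume_pos[where 'd = 'd] unfolding D_def by (simp only: mult_cancel_left vec_lambda_beta) simp
  qed
  then show ?thesis by (auto simp: H1_def)
qed

lemma has_sum_sum_finite: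
  fixes f :: "'i \<Rightarrow> 'a \<Rightarrow> 'b::topological_comm_monoid_add"
  assumes "finite I" "\<And>i. i \<in> I \<Longrightarrow> (f i has_sum s i) A"
  shows "((\<lambda>x. \<Sum>i\<in>I. f i x) has_sum (\<Sum>i\<in>I. s i)) A"
  using assms by (induction I rule: finite_induct) (auto intro: has_sum_add)

text \<open>
  Frequency by frequency, both sides are \<open>- \<bar>k\<bar>\<^sup>2\<close> times the inner product of the coefficients of
  \<open>u\<close> and \<open>v\<close>. Summation by Parseval's identity takes the place of approximating \<open>v\<close> by test
  functions.
\<close>

proposition weak_green_identity:
  fixes u v w :: "real ^ 'd::finite \<Rightarrow> real"
  assumes uw: "has_weak_laplacian u w" and ug: "has_weak_grad u g" and vh: "has_weak_grad v h"
  shows "(LINT x|torus. w x * v x) = - (\<Sum>i\<in>UNIV. LINT x|torus. g x $ i * h x $ i)"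
proof -
  have sq: "square_integrable torus w" "square_integrable torus v"
      "\<And>i. square_integrable torus (\<lambda>x. g x $ i)" "\<And>i. square_integrable torus (\<lambda>x. h x $ i)"
    using uw ug vh by (auto simp: has_weak_laplacian_def has_weak_grad_def L2_iff)
  have "((\<lambda>k. \<Sum>i\<in>UNIV. fourier (\<lambda>x. g x $ i) k \<bullet> fourier (\<lambda>x. h x $ i) k) has_sum
      (\<Sum>i\<in>UNIV. volume TYPE('d) * (LINT x|torus. g x $ i * h x $ i))) UNIV"
    by (intro has_sum_sum_finite parseval sq) simp
  moreover have "(\<Sum>i\<in>UNIV. fourier (\<lambda>x. g x $ i) k \<bullet> fourier (\<lambda>x. h x $ i) k)
      = - (fourier w k \<bullet> fourier v k)" for k
  proof -
    define z where "z = fourier u k \<bullet> fourier v k"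
    have "fourier (\<lambda>x. g x $ i) k \<bullet> fourier (\<lambda>x. h x $ i) k = (of_int (k $ i))\<^sup>2 * z" for i
      unfolding fourier_weak_grad[OF ug] fourier_weak_grad[OF vh] z_def
      by (simp add: inner_complex_def power2_eq_square algebra_simps)
    moreover have "fourier w k \<bullet> fourier v k = - ((\<Sum>i\<in>UNIV. (of_int (k $ i))\<^sup>2) * z)"
      unfolding fourier_weak_laplacian[OF uw] z_def
      by (simp only: scaleR_conv_of_real[symmetric] mult_minus_left inner_minus_left inner_scaleR_left)
    ultimately show ?thesis by (simp add: sum_distrib_right)
  qed
  ultimately have "((\<lambda>k. fourier w k \<bullet> fourier v k) has_sum
      - (volume TYPE('d) * (\<Sum>i\<in>UNIV. LINT x|torus. g x $ i * h x $ i))) UNIV"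
    by (simp add: has_sum_uminus sum_distrib_left)
  from has_sum_unique[OF this parseval[OF sq(1,2)]]
  have "volume TYPE('d) * (LINT x|torus. w x * v x)
      = volume TYPE('d) * (- (\<Sum>i\<in>UNIV. LINT x|torus. g x $ i * h x $ i))"
    by (simp only: mult_minus_right)
  then show ?thesis
    using volume_pos[where 'd = 'd] by (simp only: mult_cancel_left) simp
qed

section \<open>Energy decay\<close>

text \<open>The function \<open>x\<^sup>2 / 2 - cos x\<close> is convex and lies above its tangent at \<open>b\<close>.\<close>

lemma cos_le_quadratic:
  fixes a b :: real
  shows "cos a \<le> cos b - sin b * (a - b) + (a - b)\<^sup>2 / 2"
proof -
  have "(b + sin b) * (a - b) \<le> (a\<^sup>2 / 2 - cos a) - (b\<^sup>2 / 2 - cos b)"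
  proof (rule f''_imp_f'[where C = UNIV and f'' = "\<lambda>x. 1 + cos x"])
    show "((\<lambda>x. x\<^sup>2 / 2 - cos x) has_field_derivative x + sin x) (at x)" for x :: real
      by (auto intro!: derivative_eq_intros)
    show "((\<lambda>x. x + sin x) has_field_derivative 1 + cos x) (at x)" for x :: real
      by (auto intro!: derivative_eq_intros)
    show "0 \<le> 1 + cos x" for x :: real using cos_ge_minus_one[of x] by linarith
  qed auto
  then show ?thesis by (simp add: power2_eq_square field_simps)
qed

lemma abs_sin_diff_le:
  fixes a b :: real
  shows "\<bar>sin a - sin b\<bar> \<le> \<bar>a - b\<bar>"
proof -
  have "norm (sin a - sin b) \<le> 1 * norm (a - b)"
    by (rule field_differentiable_bound[where S = UNIV and f' = cos])
      (auto intro!: derivative_eq_intros)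
  then show ?thesis by simp
qed

text \<open>
  With \<open>\<delta> = a - b\<close> and \<open>d = b - c\<close> the difference quotient is \<open>(3 \<delta> - d) / (2 \<tau>)\<close>. After the
  two trigonometric estimates and multiplication by \<open>4 \<tau>\<close> the claim is that
  \<open>(5 - 2 \<tau>) \<delta>\<^sup>2 + d\<^sup>2 - (2 + 4 \<tau>) \<bar>\<delta>\<bar> \<bar>d\<bar> = (\<bar>d\<bar> - (1 + 2 \<tau>) \<bar>\<delta>\<bar>)\<^sup>2 + (1 - 2 \<tau>) (4 + 2 \<tau>) \<delta>\<^sup>2\<close>
  is nonnegative, which is where \<open>\<tau> \<le> 1 / 2\<close> enters.
\<close>

lemma energy_increment_le:
  fixes a b c \<tau> :: real
  assumes \<tau>: "0 < \<tau>" "\<tau> \<le> 1 / 2"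
  shows "cos a - cos b + 1 / (4 * \<tau>) * (a - b)\<^sup>2 - 1 / (4 * \<tau>) * (b - c)\<^sup>2
    \<le> (a - b) * ((3 * a - 4 * b + c) / (2 * \<tau>) - 2 * sin b + sin c)"
proof -
  define X where "X = \<bar>a - b\<bar>"
  define Y where "Y = \<bar>b - c\<bar>"
  have sq: "(a - b)\<^sup>2 = X\<^sup>2" "(b - c)\<^sup>2 = Y\<^sup>2" by (simp_all add: X_def Y_def)
  have 1: "cos a - cos b \<le> - sin b * (a - b) + X\<^sup>2 / 2"
    using cos_le_quadratic[of a b] by (simp add: sq)
  have 2: "(a - b) * (sin b - sin c) \<le> X * Y"
  proof -
    have "\<bar>(a - b) * (sin b - sin c)\<bar> \<le> X * Y"
      unfolding X_def Y_def abs_mult by (intro mult_mono abs_sin_diff_le) auto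
    then show ?thesis by linarith
  qed
  have 3: "(a - b) * (b - c) \<le> X * Y"
    unfolding X_def Y_def abs_mult[symmetric] by simp
  have "0 \<le> (Y - (1 + 2 * \<tau>) * X)\<^sup>2 + (1 - 2 * \<tau>) * (4 + 2 * \<tau>) * X\<^sup>2"
    using \<tau> by (intro add_nonneg_nonneg mult_nonneg_nonneg) auto
  also have "\<dots> = (5 - 2 * \<tau>) * X\<^sup>2 + Y\<^sup>2 - (2 + 4 * \<tau>) * (X * Y)"
    by (simp add: power2_eq_square algebra_simps)
  finally have "0 \<le> ((5 - 2 * \<tau>) * X\<^sup>2 + Y\<^sup>2 - (2 + 4 * \<tau>) * (X * Y)) / (4 * \<tau>)"
    using \<tau> by simp
  also have "\<dots> = 3 * X\<^sup>2 / (2 * \<tau>) - X * Y / (2 * \<tau>) - X\<^sup>2 / 2 - X * Y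
      - 1 / (4 * \<tau>) * X\<^sup>2 + 1 / (4 * \<tau>) * Y\<^sup>2"
    using \<tau> by (simp add: field_simps)
  finally have quad: "1 / (4 * \<tau>) * X\<^sup>2 - 1 / (4 * \<tau>) * Y\<^sup>2
      \<le> 3 * X\<^sup>2 / (2 * \<tau>) - X * Y / (2 * \<tau>) - X\<^sup>2 / 2 - X * Y" by simp
  have "(a - b) * ((3 * a - 4 * b + c) / (2 * \<tau>) - 2 * sin b + sin c)
      = 3 * X\<^sup>2 / (2 * \<tau>) - (a - b) * (b - c) / (2 * \<tau>) - sin b * (a - b) - (a - b) * (sin b - sin c)"
    unfolding sq[symmetric] using \<tau> by (simp add: field_simps power2_eq_square)
  moreover have "(a - b) * (b - c) / (2 * \<tau>) \<le> X * Y / (2 * \<tau>)"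
    using 3 \<tau> by (intro divide_right_mono) auto
  ultimately show ?thesis using 1 2 quad unfolding sq by linarith
qed

lemma l2_norm_square: "(l2_norm f)\<^sup>2 = (LINT x|torus. (norm (f x))\<^sup>2)"
  unfolding l2_norm_def by (intro real_sqrt_pow2 integral_nonneg_AE) auto

lemma l2_norm_square_vec:
  fixes g :: "real ^ 'd::finite \<Rightarrow> real ^ 'd"
  assumes "\<And>i. square_integrable torus (\<lambda>x. g x $ i)"
  shows "(l2_norm g)\<^sup>2 = (\<Sum>i\<in>UNIV. LINT x|torus. (g x $ i)\<^sup>2)"
proof -
  have "(norm (g x))\<^sup>2 = (\<Sum>i\<in>UNIV. (g x $ i)\<^sup>2)" for x
    unfolding power2_norm_eq_inner inner_vec_def by (simp add: power2_eq_square)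
  then show ?thesis
    unfolding l2_norm_square using assms by (simp add: square_integrable_def Bochner_Integration.integral_sum)
qed

text \<open>
  The scheme is tested with \<open>U - v\<close>. Green's identity and
  \<open>- \<nabla>U \<cdot> \<nabla>(U - v) \<le> \<bar>\<nabla>v\<bar>\<^sup>2 / 2 - \<bar>\<nabla>U\<bar>\<^sup>2 / 2\<close> control the Laplacian; the other terms are
  compared pointwise.
\<close>

lemma bdf2_step_energy:
  fixes U v z :: "real ^ 'd::finite \<Rightarrow> real"
  assumes \<tau>: "0 < \<tau>" "\<tau> \<le> 1 / 2" and step: "bdf2_step \<kappa> \<tau> U v z"
    and v: "v \<in> H1" and z: "z \<in> L2"
  shows "\<kappa>\<^sup>2 / 2 * (l2_norm (weak_grad U))\<^sup>2 + (LINT x|torus. cos (U x))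
      + 1 / (4 * \<tau>) * (l2_norm (\<lambda>x. U x - v x))\<^sup>2
    \<le> \<kappa>\<^sup>2 / 2 * (l2_norm (weak_grad v))\<^sup>2 + (LINT x|torus. cos (v x))
      + 1 / (4 * \<tau>) * (l2_norm (\<lambda>x. v x - z x))\<^sup>2"
proof -
  interpret finite_measure "torus :: (real ^ 'd) measure" by (rule finite_measure_torus)
  obtain w where w: "has_weak_laplacian U w"
      and eq: "AE x in torus. (3 * U x - 4 * v x + z x) / (2 * \<tau>) = \<kappa>\<^sup>2 * w x + 2 * sin (v x) - sin (z x)"
    using step by (auto simp: bdf2_step_def)
  have grad: "has_weak_grad f (weak_grad f)" if "f \<in> H1" for f :: "real ^ 'd \<Rightarrow> real"
    using that someI_ex[of "has_weak_grad f"] by (auto simp: H1_def weak_grad_def)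
  note gU = grad[OF weak_laplacian_imp_H1[OF w]] and gv = grad[OF v]
  have sq: "square_integrable torus U" "square_integrable torus v" "square_integrable torus z"
      "square_integrable torus w" "\<And>i. square_integrable torus (\<lambda>x. weak_grad U x $ i)"
      "\<And>i. square_integrable torus (\<lambda>x. weak_grad v x $ i)"
    using w gU gv z by (auto simp: has_weak_laplacian_def has_weak_grad_def L2_iff)
  have int_cos: "integrable torus (\<lambda>x. cos (f x))" if "square_integrable torus f" for f :: "real ^ 'd \<Rightarrow> real"
  proof -
    have [measurable]: "f \<in> borel_measurable torus" using that by (simp add: square_integrable_def)
    show ?thesis by (intro integrable_const_bound[where B = 1]) auto
  qed
  have int: "integrable torus (\<lambda>x. (U x - v x)\<^sup>2)" "integrable torus (\<lambda>x. (v x - z x)\<^sup>2)"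
      "integrable torus (\<lambda>x. w x * U x)" "integrable torus (\<lambda>x. w x * v x)"
    using square_integrable_diff[OF sq(1,2)] square_integrable_diff[OF sq(2,3)] sq
    by (auto simp: square_integrable_def intro: square_integrable_mult[unfolded square_integrable_def])
  have "(LINT x|torus. cos (U x) - cos (v x) + 1 / (4 * \<tau>) * (U x - v x)\<^sup>2 - 1 / (4 * \<tau>) * (v x - z x)\<^sup>2)
      \<le> (LINT x|torus. \<kappa>\<^sup>2 * (w x * U x - w x * v x))"
  proof (rule integral_mono_AE)
    show "AE x in torus. cos (U x) - cos (v x) + 1 / (4 * \<tau>) * (U x - v x)\<^sup>2 - 1 / (4 * \<tau>) * (v x - z x)\<^sup>2
        \<le> \<kappa>\<^sup>2 * (w x * U x - w x * v x)"
      using eq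
    proof eventually_elim
      case (elim x)
      have "(U x - v x) * ((3 * U x - 4 * v x + z x) / (2 * \<tau>) - 2 * sin (v x) + sin (z x))
          = \<kappa>\<^sup>2 * (w x * U x - w x * v x)"
        unfolding elim by (simp add: algebra_simps)
      then show ?case using energy_increment_le[OF \<tau>, of "U x" "v x" "z x"] by simp
    qed
  qed (use int int_cos sq in auto)
  then have "(LINT x|torus. cos (U x)) - (LINT x|torus. cos (v x))
      + 1 / (4 * \<tau>) * (LINT x|torus. (U x - v x)\<^sup>2) - 1 / (4 * \<tau>) * (LINT x|torus. (v x - z x)\<^sup>2)
      \<le> \<kappa>\<^sup>2 * ((LINT x|torus. w x * U x) - (LINT x|torus. w x * v x))"
    using int int_cos sq by simp
  also have "\<dots> \<le> \<kappa>\<^sup>2 * ((l2_norm (weak_grad v))\<^sup>2 / 2 - (l2_norm (weak_grad U))\<^sup>2 / 2)"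
  proof (rule mult_left_mono)
    let ?G = "weak_grad U" and ?H = "weak_grad v"
    have "(LINT x|torus. ?G x $ i * ?H x $ i) \<le> (LINT x|torus. (?G x $ i)\<^sup>2) / 2 + (LINT x|torus. (?H x $ i)\<^sup>2) / 2" for i
    proof -
      have i: "integrable torus (\<lambda>x. (?G x $ i)\<^sup>2)" "integrable torus (\<lambda>x. (?H x $ i)\<^sup>2)"
        using sq(5,6)[of i] by (auto simp: square_integrable_def)
      have "(LINT x|torus. ?G x $ i * ?H x $ i) \<le> (LINT x|torus. (?G x $ i)\<^sup>2 / 2 + (?H x $ i)\<^sup>2 / 2)"
      proof (rule integral_mono)
        show "?G x $ i * ?H x $ i \<le> (?G x $ i)\<^sup>2 / 2 + (?H x $ i)\<^sup>2 / 2" for x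
          using zero_le_power2[of "?G x $ i - ?H x $ i"] unfolding power2_diff by simp
      qed (use i in \<open>auto intro: square_integrable_mult sq\<close>)
      then show ?thesis using i by simp
    qed
    then have "(\<Sum>i\<in>UNIV. LINT x|torus. ?G x $ i * ?H x $ i)
        \<le> (\<Sum>i\<in>UNIV. (LINT x|torus. (?G x $ i)\<^sup>2) / 2 + (LINT x|torus. (?H x $ i)\<^sup>2) / 2)"
      by (rule sum_mono)
    then have "(\<Sum>i\<in>UNIV. LINT x|torus. ?G x $ i * ?H x $ i) \<le> (l2_norm ?G)\<^sup>2 / 2 + (l2_norm ?H)\<^sup>2 / 2"
      by (simp add: l2_norm_square_vec sq sum.distrib sum_divide_distrib)
    moreover have "(LINT x|torus. w x * U x) = - (l2_norm ?G)\<^sup>2"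
      unfolding l2_norm_square_vec[OF sq(5)] using weak_green_identity[OF w gU gU]
      by (simp add: power2_eq_square)
    ultimately show "(LINT x|torus. w x * U x) - (LINT x|torus. w x * v x)
        \<le> (l2_norm ?H)\<^sup>2 / 2 - (l2_norm ?G)\<^sup>2 / 2"
      using weak_green_identity[OF w gU gv] by linarith
  qed simp
  finally show ?thesis
    unfolding l2_norm_square[of "\<lambda>x. U x - v x"] l2_norm_square[of "\<lambda>x. v x - z x"]
    by (simp add: right_diff_distrib)
qed

theorem theorem4p3:
  fixes u :: "nat \<Rightarrow> real ^ 'd::finite \<Rightarrow> real" and \<kappa> \<tau> :: real
  assumes "\<kappa> > 0"
    and "u 0 \<in> H1" and "u 1 \<in> H1"
    and "\<And>n. n \<ge> 1 \<Longrightarrow> bdf2_step \<kappa> \<tau> (u (n + 1)) (u n) (u (n - 1))"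
    and "0 < \<tau>" and "\<tau> \<le> 1 / 2"
  shows "\<forall>n\<ge>1. modified_energy \<kappa> \<tau> u (n + 1) \<le> modified_energy \<kappa> \<tau> u n"
proof (intro allI impI)
  have H1: "u n \<in> H1" for n
  proof (cases "n \<le> 1")
    case True
    then show ?thesis using assms(2,3) by (cases n) auto
  next
    case False
    then have "bdf2_step \<kappa> \<tau> (u n) (u (n - 1)) (u (n - 1 - 1))"
      using assms(4)[of "n - 1"] by simp
    then show ?thesis unfolding bdf2_step_def by (auto intro: weak_laplacian_imp_H1)
  qed
  fix n :: nat assume n: "n \<ge> 1"
  have "u (n - 1) \<in> L2" using H1[of "n - 1"] by (auto simp: H1_def has_weak_grad_def)
  then show "modified_energy \<kappa> \<tau> u (n + 1) \<le> modified_energy \<kappa> \<tau> u n"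
    using bdf2_step_energy[OF assms(5,6) assms(4)[OF n] H1]
    by (simp add: modified_energy_def)
qed

end
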